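(* Let $n\ge 2$ and $0<\alpha<\frac{\pi}{4}$. The $n$-dimensional hyperbolic sector $\mathcal{D}^h_{\alpha,n}$ and the $n$-dimensional hyperbolic segment $\mathcal{S}^h_{\alpha,n}$ are $n$-bricks.
   Context: Use polar coordinates in $\mathbb{R}^2$: $(x,y)=(\rho\cos\theta,\rho\sin\theta)$ with $(\rho,\theta)\in[0,+\infty)\times(-\pi,\pi]$. For $0<\alpha<\frac{\pi}{4}$ define the planar hyperbolic sector $\mathcal{D}^h_\alpha:=\{-\alpha\le\theta\le\alpha,\ \rho^2\cos(2\theta)\le1\}\subset\mathbb{R}^2$ and the planar hyperbolic segment $\mathcal{S}^h_\alpha:=\big\{-\alpha\le\theta\le\alpha,\ \frac{\cos\theta}{\sqrt{\cos(2\theta)}}\le\rho\cos\theta\le\frac{\cos\alpha}{\sqrt{\cos(2\alpha)}}\big\}\subset\mathbb{R}^2$. With $\mathbb{S}^{n-2}$ the unit sphere of $\mathbb{R}^{n-1}$ centered at the origin, define $$\mathcal{D}^h_{\alpha,n}:=\{(a,bu)\in\mathbb{R}\times\mathbb{R}^{n-1}:\ (a,b)\in\mathcal{D}^h_\alpha,\ u\in\mathbb{S}^{n-2}\},\qquad \mathcal{S}^h_{\alpha,n}:=\{(a,bu)\in\mathbb{R}\times\mathbb{R}^{n-1}:\ (a,b)\in\mathcal{S}^h_\alpha,\ u\in\mathbb{S}^{n-2}\}.$$ $\overline{B}_m$ denotes the closed unit ball of $\mathbb{R}^m$ centered at the origin. An $n$-dimensional semialgebraic set $T\subset\mathbb{R}^n$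 is an $m$-brick if there exists a homotopy $H=(H_1,\ldots,H_n):[0,1]\times\overline{B}_m\to T$ such that: (1) each $H_i$ is the restriction to $[0,1]\times\overline{B}_m$ of a polynomial of the ring $\mathcal{C}^0([0,1])[x_1,\ldots,x_m]$, where $\mathcal{C}^0([0,1])$ is the ring of continuous real functions on $[0,1]$; (2) $H(\{0\}\times\overline{B}_m)=T$ and $H(1,\cdot)$ is a constant map; (3) $H(\{t\}\times\overline{B}_m)\subset\operatorname{Int}(T)$ for each $t\in(0,1)$, where $\operatorname{Int}$ is the topological interior in $\mathbb{R}^n$. *)

theory Defs
  imports "HOL-Analysis.Analysis"
begin

text \<open>
  Throughout, \<open>\<real>\<^sup>n\<close> is the library space \<^const>\<open>Euclidean_space\<close> \<open>n\<close>: functions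
  \<open>x :: nat \<Rightarrow> real\<close> with coordinates \<open>x 0, \<dots>, x (n - 1)\<close> that vanish from index \<open>n\<close> on.
\<close>

definition unit_cball :: "nat \<Rightarrow> (nat \<Rightarrow> real) set" where
  "unit_cball m = {x \<in> topspace (Euclidean_space m). (\<Sum>i<m. (x i)\<^sup>2) \<le> 1}"


section \<open>Polynomial functions and semialgebraic sets\<close>

definition monom_eval :: "nat \<Rightarrow> (nat \<Rightarrow> nat) \<Rightarrow> (nat \<Rightarrow> real) \<Rightarrow> real" where
  "monom_eval m e x = (\<Prod>j<m. x j ^ e j)"

definition real_polynomial :: "nat \<Rightarrow> ((nat \<Rightarrow> real) \<Rightarrow> real) \<Rightarrow> bool" where
  "real_polynomial m f \<longleftrightarrow>
     (\<exists>(E :: (nat \<Rightarrow> nat) set) c. finite E \<and>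
        (\<forall>x. f x = (\<Sum>e\<in>E. c e * monom_eval m e x)))"

text \<open>
  \<open>h\<close> restricts on \<open>[0,1] \<times> B\<close> to an element of \<open>C\<^sup>0([0,1])[x\<^sub>1, \<dots>, x\<^sub>m]\<close>.  The set \<open>E\<close> of
  exponents does not depend on the parameter \<open>t\<close>.
\<close>
definition C0_polynomial_on ::
    "nat \<Rightarrow> (nat \<Rightarrow> real) set \<Rightarrow> (real \<times> (nat \<Rightarrow> real) \<Rightarrow> real) \<Rightarrow> bool" where
  "C0_polynomial_on m B h \<longleftrightarrow>
     (\<exists>(E :: (nat \<Rightarrow> nat) set) c. finite E \<and>
        (\<forall>e\<in>E. continuous_on {0..1} (c e)) \<and>
        (\<forall>t\<in>{0..1}. \<forall>x\<in>B. h (t, x) = (\<Sum>e\<in>E. c e t * monom_eval m e x)))"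

inductive semialgebraic :: "nat \<Rightarrow> (nat \<Rightarrow> real) set \<Rightarrow> bool" for n where
  pos: "real_polynomial n f \<Longrightarrow>
          semialgebraic n {x \<in> topspace (Euclidean_space n). f x > 0}"
| compl: "semialgebraic n S \<Longrightarrow> semialgebraic n (topspace (Euclidean_space n) - S)"
| union: "semialgebraic n S \<Longrightarrow> semialgebraic n T \<Longrightarrow> semialgebraic n (S \<union> T)"
| inter: "semialgebraic n S \<Longrightarrow> semialgebraic n T \<Longrightarrow> semialgebraic n (S \<inter> T)"

text \<open>
  The dimension of a nonempty semialgebraic set is the largest dimension of a cell contained in
  it, a \<open>d\<close>-dimensional cell being a homeomorphic copy of \<open>(0,1)\<^sup>d\<close>, equivalently of \<open>\<real>\<^sup>d\<close>.
\<close>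
definition contains_cell :: "nat \<Rightarrow> (nat \<Rightarrow> real) set \<Rightarrow> nat \<Rightarrow> bool" where
  "contains_cell n T d \<longleftrightarrow>
     (\<exists>S\<subseteq>T. subtopology (Euclidean_space n) S homeomorphic_space Euclidean_space d)"

definition has_dimension :: "nat \<Rightarrow> (nat \<Rightarrow> real) set \<Rightarrow> nat \<Rightarrow> bool" where
  "has_dimension n T d \<longleftrightarrow>
     contains_cell n T d \<and> (\<forall>d'. contains_cell n T d' \<longrightarrow> d' \<le> d)"


section \<open>Bricks\<close>

definition brick_homotopy ::
    "nat \<Rightarrow> nat \<Rightarrow> (nat \<Rightarrow> real) set \<Rightarrow> (real \<times> (nat \<Rightarrow> real) \<Rightarrow> (nat \<Rightarrow> real)) \<Rightarrow> bool" where
  "brick_homotopy m n T H \<longleftrightarrow>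
     continuous_map
       (prod_topology (top_of_set {0..1}) (subtopology (Euclidean_space m) (unit_cball m)))
       (subtopology (Euclidean_space n) T) H \<and>
     (\<forall>i<n. C0_polynomial_on m (unit_cball m) (\<lambda>p. H p i)) \<and>
     H ` ({0} \<times> unit_cball m) = T \<and>
     (\<exists>p. \<forall>x\<in>unit_cball m. H (1, x) = p) \<and>
     (\<forall>t\<in>{0<..<1}. H ` ({t} \<times> unit_cball m) \<subseteq> Euclidean_space n interior_of T)"

text \<open>\<open>brick m n T\<close>: the set \<open>T \<subseteq> \<real>\<^sup>n\<close> is an \<open>m\<close>-brick.\<close>
definition brick :: "nat \<Rightarrow> nat \<Rightarrow> (nat \<Rightarrow> real) set \<Rightarrow> bool" where
  "brick m n T \<longleftrightarrow>
     semialgebraic n T \<and> has_dimension n T n \<and> (\<exists>H. brick_homotopy m n T H)"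


section \<open>Hyperbolic sectors and segments\<close>

definition planar_hyp_sector :: "real \<Rightarrow> (real \<times> real) set" where
  "planar_hyp_sector \<alpha> =
     {(\<rho> * cos \<theta>, \<rho> * sin \<theta>) | \<rho> \<theta>.
        0 \<le> \<rho> \<and> -pi < \<theta> \<and> \<theta> \<le> pi \<and>
        -\<alpha> \<le> \<theta> \<and> \<theta> \<le> \<alpha> \<and> \<rho>\<^sup>2 * cos (2 * \<theta>) \<le> 1}"

definition planar_hyp_segment :: "real \<Rightarrow> (real \<times> real) set" where
  "planar_hyp_segment \<alpha> =
     {(\<rho> * cos \<theta>, \<rho> * sin \<theta>) | \<rho> \<theta>.
        0 \<le> \<rho> \<and> -pi < \<theta> \<and> \<theta> \<le> pi \<and>
        -\<alpha> \<le> \<theta> \<and> \<theta> \<le> \<alpha> \<and>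
        cos \<theta> / sqrt (cos (2 * \<theta>)) \<le> \<rho> * cos \<theta> \<and>
        \<rho> * cos \<theta> \<le> cos \<alpha> / sqrt (cos (2 * \<alpha>))}"

text \<open>The point \<open>(a, v)\<close> of \<open>\<real> \<times> \<real>\<^sup>n\<^sup>-\<^sup>1 = \<real>\<^sup>n\<close>.\<close>
definition cons_point :: "real \<Rightarrow> (nat \<Rightarrow> real) \<Rightarrow> (nat \<Rightarrow> real)" where
  "cons_point a v = (\<lambda>i. case i of 0 \<Rightarrow> a | Suc j \<Rightarrow> v j)"

text \<open>
  The set of all \<open>(a, b u)\<close> with \<open>(a, b) \<in> P\<close> and \<open>u\<close> in the unit sphere of \<open>\<real>\<^sup>n\<^sup>-\<^sup>1\<close>, for \<open>n \<ge> 2\<close>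
  (\<^const>\<open>nsphere\<close> \<open>k\<close> is the unit sphere of \<open>\<real>\<^sup>k\<^sup>+\<^sup>1\<close>, and \<open>n - 2\<close> is truncated subtraction).
\<close>
definition rotate_planar :: "nat \<Rightarrow> (real \<times> real) set \<Rightarrow> (nat \<Rightarrow> real) set" where
  "rotate_planar n P =
     {cons_point a (\<lambda>j. b * u j) | a b u. (a, b) \<in> P \<and> u \<in> topspace (nsphere (n - 2))}"

definition hyp_sector :: "nat \<Rightarrow> real \<Rightarrow> (nat \<Rightarrow> real) set" where
  "hyp_sector n \<alpha> = rotate_planar n (planar_hyp_sector \<alpha>)"

definition hyp_segment :: "nat \<Rightarrow> real \<Rightarrow> (nat \<Rightarrow> real) set" where
  "hyp_segment n \<alpha> = rotate_planar n (planar_hyp_segment \<alpha>)"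

end

theory Submission
  imports Defs "HOL-Homology.Invariance_of_Domain"
begin

text \<open>
  Write \<open>N x = x\<^sub>1\<^sup>2 + \<dots> + x\<^sub>n\<^sub>-\<^sub>1\<^sup>2\<close> for the squared distance from the axis.  Both bodies are solids
  of revolution \<open>{x. R (x\<^sub>0) (N x)}\<close>, where the relation \<open>R a \<beta>\<close> consists of three polynomial inequalities
  in the position \<open>a\<close> on the axis and the squared radius \<open>\<beta>\<close>: with \<open>\<tau> = tan \<alpha>\<close> and
  \<open>A = cos \<alpha> / sqrt (cos 2\<alpha>)\<close> they are \<open>0 \<le> a\<close>, \<open>\<beta> \<le> \<tau>\<^sup>2 a\<^sup>2\<close>, \<open>a\<^sup>2 - \<beta> \<le> 1\<close> for the sector and
  \<open>0 \<le> a \<le> A\<close>, \<open>1 \<le> a\<^sup>2 - \<beta>\<close> for the segment.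

  Each body is strictly star-shaped about a suitable point \<open>p\<close> of the axis: moving any point of the body
  a little towards \<open>p\<close> makes all inequalities strict.  For the segment, which is convex, any inner point
  of the axis does; for the sector, \<open>p\<close> has to lie below the tangent hyperplanes of the hyperboloid,
  which holds close enough to the apex.  Hence, once the body is the image of the ball under
  a polynomial map \<open>G\<close>, the straight-line homotopy \<open>(1 - t) G + t p\<close> makes it a brick
  (\<open>brick_star_shaped\<close>).

  The map \<open>G\<close> is built in three steps, all of them symmetric about the axis, so that only the
  half-plane matters (\<open>axial_map_image\<close>).  The map \<open>(x, w) \<mapsto> (4 x\<^sup>2 (1 - x\<^sup>2), (3 - 4 |w|\<^sup>2) w)\<close>, essentially
  Chebyshev polynomials in each variable, takes the ball onto the cylinder of all \<open>(s, w)\<close> with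
  \<open>0 \<le> s \<le> 1\<close> and \<open>|w| \<le> 1\<close>.  Such a cylinder is easily mapped to a region that follows the body along
  rays or slices, but the hyperbola has no polynomial parametrization, so the curved boundary is
  produced by a fold inside the ball.  The fold is provided by the bump
  \<open>u \<mapsto> c u (1 - u\<^sup>2)\<^sup>k\<close>, which maps \<open>[0,1]\<close> to itself and attains the value \<open>1\<close> at \<open>u = 1 / sqrt (2k + 1)\<close>
  (\<open>bump_exists\<close>).  It is applied to a quantity \<open>u\<close> of which only \<open>u\<^sup>2\<close> is polynomial; since the bump is odd, the square roots cancel.
  For large \<open>k\<close> its maximum lies so close to \<open>0\<close> that every ray or slice reaches it, and therefore is
  covered exactly up to the hyperboloid.
\<close>

section \<open>Polynomial functions and basic closed sets\<close>

text \<open>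
  Repeated exponents are harmless: their coefficients are added up.  This allows sums indexed by
  disjoint unions and products in the closure properties below.
\<close>
lemma real_polynomial_sum_monomials:
  assumes "finite I" and f: "\<And>x. f x = (\<Sum>i\<in>I. c i * monom_eval m (e i) x)"
  shows "real_polynomial m f"
  unfolding real_polynomial_def
proof (intro exI conjI allI)
  show "finite (e ` I)" using assms by simp
  fix x
  have "f x = (\<Sum>y\<in>e ` I. \<Sum>i | i \<in> I \<and> e i = y. c i * monom_eval m (e i) x)"
    unfolding f by (rule sum.image_gen[OF \<open>finite I\<close>])
  also have "\<dots> = (\<Sum>y\<in>e ` I. (\<Sum>i | i \<in> I \<and> e i = y. c i) * monom_eval m y x)"
    by (auto simp: sum_distrib_right intro!: sum.cong)
  finally show "f x = (\<Sum>y\<in>e ` I. (\<Sum>i | i \<in> I \<and> e i = y. c i) * monom_eval m y x)" .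
qed

lemma monom_eval_add: "monom_eval m (\<lambda>j. e j + e' j) x = monom_eval m e x * monom_eval m e' x"
  by (simp add: monom_eval_def power_add prod.distrib)

lemma monom_eval_zero [simp]: "monom_eval m (\<lambda>_. 0) x = 1"
  by (simp add: monom_eval_def)

lemma real_polynomial_const [intro]: "real_polynomial m (\<lambda>x. c)"
  by (rule real_polynomial_sum_monomials[of "{()}" _ "\<lambda>_. c" _ "\<lambda>_ _. 0"]) auto

lemma real_polynomial_coord [intro]:
  assumes "i < m" shows "real_polynomial m (\<lambda>x. x i)"
proof (rule real_polynomial_sum_monomials[of "{()}" _ "\<lambda>_. 1" _ "\<lambda>_ j. if j = i then 1 else 0"])
  fix x :: "nat \<Rightarrow> real"
  have "(\<Prod>j<m. x j ^ (if j = i then 1 else 0)) = (\<Prod>j<m. if j = i then x i else 1)"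
    by (rule prod.cong) auto
  then show "x i = (\<Sum>_\<in>{()}. 1 * monom_eval m (\<lambda>j. if j = i then 1 else 0) x)"
    using assms by (simp add: monom_eval_def)
qed simp

lemma real_polynomial_add [intro]:
  assumes "real_polynomial m f" "real_polynomial m g"
  shows "real_polynomial m (\<lambda>x. f x + g x)"
proof -
  obtain E c where E: "finite E" "\<And>x. f x = (\<Sum>e\<in>E. c e * monom_eval m e x)"
    using assms(1) by (auto simp: real_polynomial_def)
  obtain F d where F: "finite F" "\<And>x. g x = (\<Sum>e\<in>F. d e * monom_eval m e x)"
    using assms(2) by (auto simp: real_polynomial_def)
  show ?thesis
    using E F
    by (intro real_polynomial_sum_monomials[of "E <+> F" _ "case_sum c d" _ "case_sum id id"])
       (auto simp: sum.Plus)
qed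

lemma real_polynomial_mult [intro]:
  assumes "real_polynomial m f" "real_polynomial m g"
  shows "real_polynomial m (\<lambda>x. f x * g x)"
proof -
  obtain E c where E: "finite E" "\<And>x. f x = (\<Sum>e\<in>E. c e * monom_eval m e x)"
    using assms(1) by (auto simp: real_polynomial_def)
  obtain F d where F: "finite F" "\<And>x. g x = (\<Sum>e\<in>F. d e * monom_eval m e x)"
    using assms(2) by (auto simp: real_polynomial_def)
  show ?thesis
    using E F
    by (intro real_polynomial_sum_monomials[of "E \<times> F" _ "\<lambda>(e, e'). c e * d e'" _
            "\<lambda>(e, e') j. e j + e' j"])
       (auto simp: monom_eval_add sum_product sum.cartesian_product intro!: sum.cong)
qed

lemma real_polynomial_uminus [intro]:
  "real_polynomial m f \<Longrightarrow> real_polynomial m (\<lambda>x. - f x)"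
  using real_polynomial_mult[OF real_polynomial_const[of m "-1"]] by auto

lemma real_polynomial_diff [intro]:
  "real_polynomial m f \<Longrightarrow> real_polynomial m g \<Longrightarrow> real_polynomial m (\<lambda>x. f x - g x)"
  using real_polynomial_add[OF _ real_polynomial_uminus] by fastforce

lemma real_polynomial_power [intro]:
  "real_polynomial m f \<Longrightarrow> real_polynomial m (\<lambda>x. f x ^ k)"
  by (induction k) auto

lemma real_polynomial_sum [intro]:
  "(\<And>i. i \<in> I \<Longrightarrow> real_polynomial m (f i)) \<Longrightarrow> real_polynomial m (\<lambda>x. \<Sum>i\<in>I. f i x)"
  by (induction I rule: infinite_finite_induct) auto

lemmas real_polynomial_intros = real_polynomial_const real_polynomial_coord real_polynomial_add
  real_polynomial_diff real_polynomial_mult real_polynomial_power real_polynomial_uminus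

lemma real_polynomial_continuous_on:
  assumes "real_polynomial m f" shows "continuous_on S f"
proof -
  obtain E c where f: "f = (\<lambda>x. \<Sum>e\<in>E. c e * monom_eval m e x)"
    using assms by (auto simp: real_polynomial_def)
  have "continuous_on UNIV f"
    unfolding f monom_eval_def by (intro continuous_intros continuous_on_product_coordinates)
  then show ?thesis by (rule continuous_on_subset) simp
qed

text \<open>
  The zero exponent is added to the exponents of \<open>f\<close> to make room for the constant term \<open>t p\<close>.
\<close>
lemma C0_polynomial_on_homotopy:
  assumes "real_polynomial m f"
  shows "C0_polynomial_on m B (\<lambda>(t, x). (1 - t) * f x + t * p)"
proof -
  obtain E c where E: "finite E" "\<And>x. f x = (\<Sum>e\<in>E. c e * monom_eval m e x)"
    using assms by (auto simp: real_polynomial_def)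
  let ?z = "(\<lambda>_. 0) :: nat \<Rightarrow> nat"
  define d where "d = (\<lambda>e t. (1 - t) * (if e \<in> E then c e else 0) + t * (if e = ?z then p else 0))"
  show ?thesis
    unfolding C0_polynomial_on_def
  proof (intro exI conjI ballI)
    show "finite (insert ?z E)" using E by simp
    show "continuous_on {0..1} (d e)" for e
      unfolding d_def by (intro continuous_intros)
    fix t :: real and x
    have "f x = (\<Sum>e\<in>insert ?z E. (if e \<in> E then c e else 0) * monom_eval m e x)"
      unfolding E(2) using E(1) by (intro sum.mono_neutral_cong_left) auto
    moreover have "p = (\<Sum>e\<in>insert ?z E. (if e = ?z then p else 0) * monom_eval m e x)"
      using E(1) by (simp add: if_distrib[where f = "\<lambda>u. u * _"] cong: if_cong)
    ultimately have "(1 - t) * f x + t * p =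
      (1 - t) * (\<Sum>e\<in>insert ?z E. (if e \<in> E then c e else 0) * monom_eval m e x) +
      t * (\<Sum>e\<in>insert ?z E. (if e = ?z then p else 0) * monom_eval m e x)" by simp
    also have "\<dots> = (\<Sum>e\<in>insert ?z E. d e t * monom_eval m e x)"
      unfolding d_def sum_distrib_left sum.distrib[symmetric] by (intro sum.cong) (auto simp: algebra_simps)
    finally show "(case (t, x) of (t, x) \<Rightarrow> (1 - t) * f x + t * p) =
       (\<Sum>e\<in>insert ?z E. d e t * monom_eval m e x)" by simp
  qed
qed

lemma semialgebraic_basic_closed:
  assumes "finite F" "\<And>f. f \<in> F \<Longrightarrow> real_polynomial n f"
  shows "semialgebraic n {x \<in> topspace (Euclidean_space n). \<forall>f\<in>F. 0 \<le> f x}"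
  using assms
proof (induction F rule: finite_induct)
  case empty
  then show ?case
    using semialgebraic.pos[OF real_polynomial_const[of n 1]] by simp
next
  case (insert f F)
  have "semialgebraic n (topspace (Euclidean_space n) - {x \<in> topspace (Euclidean_space n). - f x > 0})"
    using insert.prems by (intro semialgebraic.compl semialgebraic.pos) auto
  then have "semialgebraic n ((topspace (Euclidean_space n) - {x \<in> topspace (Euclidean_space n). - f x > 0})
      \<inter> {x \<in> topspace (Euclidean_space n). \<forall>f\<in>F. 0 \<le> f x})"
    using insert by (intro semialgebraic.inter) auto
  also have "\<dots> = {x \<in> topspace (Euclidean_space n). \<forall>f\<in>insert f F. 0 \<le> f x}"
    by auto
  finally show ?case .
qed

section \<open>Cells and dimension\<close>

lemma Euclidean_space_top_of_set: "Euclidean_space n = top_of_set (topspace (Euclidean_space n))"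
  by (simp add: Euclidean_space_def euclidean_product_topology)

text \<open>
  If \<open>d > n\<close>, a homeomorphic copy of \<open>\<real>\<^sup>d\<close> inside \<open>\<real>\<^sup>n \<subseteq> \<real>\<^sup>d\<close> would be open in \<open>\<real>\<^sup>d\<close> by invariance of
  domain; but a subset of \<open>\<real>\<^sup>n\<close> leaves no room to vary the coordinate with index \<open>n\<close>.
\<close>
lemma contains_cell_le:
  assumes "contains_cell n T d"
  shows "d \<le> n"
proof (rule ccontr)
  assume "\<not> d \<le> n"
  obtain S where "subtopology (Euclidean_space n) S homeomorphic_space Euclidean_space d"
    using assms by (auto simp: contains_cell_def)
  then obtain f where f: "homeomorphic_map (Euclidean_space d) (subtopology (Euclidean_space n) S) f"
    using homeomorphic_space homeomorphic_space_sym by blast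
  then have f': "continuous_map (Euclidean_space d) (Euclidean_space n) f"
      "inj_on f (topspace (Euclidean_space d))"
    by (auto simp: homeomorphic_eq_everything_map continuous_map_in_subtopology)
  have sub: "topspace (Euclidean_space n) \<subseteq> topspace (Euclidean_space d)"
    using \<open>\<not> d \<le> n\<close> by simp
  let ?V = "f ` topspace (Euclidean_space d)"
  have "Euclidean_space n = subtopology (Euclidean_space d) (topspace (Euclidean_space n))"
    using sub by (subst (1 2) Euclidean_space_top_of_set) (simp add: subtopology_subtopology inf.absorb2)
  then have "continuous_map (Euclidean_space d) (Euclidean_space d) f"
    using f' by (metis continuous_map_in_subtopology)
  then have "openin (Euclidean_space d) ?V"
    using f' by (intro invariance_of_domain_Euclidean_space_gen) auto
  moreover have V: "?V \<subseteq> topspace (Euclidean_space n)"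
    using f' by (simp add: continuous_map_image_subset_topspace)
  ultimately obtain O' where O': "open O'" "?V = topspace (Euclidean_space d) \<inter> O'"
    by (metis Euclidean_space_top_of_set openin_open)
  obtain y where y: "y \<in> ?V"
    by (metis Euclidean_space_def empty_is_image ex_in_conv nontrivial_Euclidean_space null_topspace_iff_trivial)
  have "y n = 0" using y V by (auto simp: topspace_Euclidean_space)
  \<comment> \<open>Vary the coordinate with index \<open>n\<close> of a point of the image.\<close>
  define g where "g = (\<lambda>t::real. y(n := t))"
  have "continuous_on UNIV g"
    unfolding g_def
  proof (rule continuous_on_coordinatewise_then_product)
    show "continuous_on UNIV (\<lambda>t. (y(n := t)) i)" for i
      by (cases "i = n") (auto intro!: continuous_intros)
  qed
  then have "open (g -` O')"
    using O' by (simp add: open_vimage)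
  moreover have "t = 0" if "g t \<in> O'" for t
  proof -
    have "y \<in> topspace (Euclidean_space n)" using y V by blast
    then have "g t \<in> topspace (Euclidean_space d)"
      using \<open>\<not> d \<le> n\<close> by (simp add: g_def topspace_Euclidean_space)
    then have "g t \<in> topspace (Euclidean_space n)" using that V O'(2) by blast
    then have "g t n = 0" unfolding topspace_Euclidean_space by blast
    then show "t = 0" by (simp add: g_def)
  qed
  then have "g -` O' \<subseteq> {0}" by blast
  moreover have "0 \<in> g -` O'"
    using y \<open>y n = 0\<close> O'(2) by (auto simp: g_def fun_upd_idem)
  ultimately have "open {0::real}" by (metis subset_singletonD empty_iff)
  then show False by (simp add: not_open_singleton)
qed

text \<open>
  An open set contains an open box around each of its points, and \<open>x \<mapsto> x / (1 + |x|)\<close>, applied to each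
  coordinate, maps \<open>\<real>\<^sup>n\<close> homeomorphically onto the box.
\<close>
lemma contains_cell_openin:
  assumes U: "openin (Euclidean_space n) U" and "p \<in> U" "U \<subseteq> T"
  shows "contains_cell n T n"
proof -
  obtain O' where O': "open O'" "U = topspace (Euclidean_space n) \<inter> O'"
    using U by (metis Euclidean_space_top_of_set openin_open)
  obtain X where X: "p \<in> (\<Pi>\<^sub>E i\<in>UNIV. X i)" "\<And>i. open (X i)" "(\<Pi>\<^sub>E i\<in>UNIV. X i) \<subseteq> O'"
    using product_topology_open_contains_basis[of "\<lambda>_. euclideanreal" UNIV O' p] O' \<open>p \<in> U\<close>
    by (auto simp: open_fun_def)
  have "\<exists>\<epsilon>>0. ball (p i) \<epsilon> \<subseteq> X i" for i
    using X open_contains_ball by (metis PiE_mem UNIV_I)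
  then obtain e where e: "\<And>i. e i > 0" "\<And>i. ball (p i) (e i) \<subseteq> X i" by metis
  have e_nz: "e i \<noteq> 0" for i using e(1)[of i] by simp
  have p: "\<And>i. i \<ge> n \<Longrightarrow> p i = 0"
    using O' \<open>p \<in> U\<close> by (auto simp: topspace_Euclidean_space)
  define S where "S = {y \<in> topspace (Euclidean_space n). \<forall>i<n. \<bar>(y i - p i) / e i\<bar> < 1}"
  have "S \<subseteq> U"
  proof
    fix y assume y: "y \<in> S"
    have "y i \<in> X i" for i
    proof (cases "i < n")
      case True
      then have "\<bar>y i - p i\<bar> < e i" using y e(1)[of i] by (auto simp: S_def abs_divide divide_simps)
      then show ?thesis using e(2)[of i] by (auto simp: dist_real_def subset_iff)
    next
      case False
      then show ?thesis using X(1) y p by (auto simp: S_def topspace_Euclidean_space PiE_iff) (metis not_less)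
    qed
    then have "y \<in> (\<Pi>\<^sub>E i\<in>UNIV. X i)" by auto
    then show "y \<in> U" using X(3) y O'(2) by (auto simp: S_def)
  qed
  \<comment> \<open>On a box with half-widths \<open>e i\<close>, the inverse of \<open>x / (1 + |x|)\<close> is \<open>z / (1 - |z|)\<close>.\<close>
  define \<phi> where "\<phi> = (\<lambda>x i. if i < n then p i + e i * (x i / (1 + \<bar>x i\<bar>)) else (0::real))"
  define \<psi> where "\<psi> = (\<lambda>y i. if i < n then ((y i - p i) / e i) / (1 - \<bar>(y i - p i) / e i\<bar>) else (0::real))"
  have sub: "subtopology (Euclidean_space n) S = top_of_set S"
    by (subst Euclidean_space_top_of_set) (auto simp: subtopology_subtopology S_def inf_absorb2)
  have \<phi>: "\<phi> x \<in> S" for x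
  proof -
    have "\<bar>x i\<bar> < \<bar>1 + \<bar>x i\<bar>\<bar>" for i by auto
    then have "\<bar>x i / (1 + \<bar>x i\<bar>)\<bar> < 1" for i by (simp add: abs_divide)
    moreover have "(\<phi> x i - p i) / e i = x i / (1 + \<bar>x i\<bar>)" if "i < n" for i
      using that less_imp_neq[OF e(1)[of i]] by (simp add: \<phi>_def)
    ultimately have "\<bar>(\<phi> x i - p i) / e i\<bar> < 1" if "i < n" for i
      using that by (simp only:)
    moreover have "\<phi> x \<in> topspace (Euclidean_space n)"
      by (simp add: \<phi>_def topspace_Euclidean_space)
    ultimately show ?thesis unfolding S_def by blast
  qed
  have \<psi>: "\<psi> y \<in> topspace (Euclidean_space n)" for y
    by (simp add: \<psi>_def topspace_Euclidean_space)
  have \<psi>\<phi>: "\<psi> (\<phi> x) = x" if "x \<in> topspace (Euclidean_space n)" for x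
  proof
    fix i
    have "1 - \<bar>x i\<bar> / (1 + \<bar>x i\<bar>) = 1 / (1 + \<bar>x i\<bar>)" by (simp add: field_simps)
    then show "\<psi> (\<phi> x) i = x i"
      using that less_imp_neq[OF e(1)[of i]] by (auto simp: \<psi>_def \<phi>_def topspace_Euclidean_space)
  qed
  have \<phi>\<psi>: "\<phi> (\<psi> y) = y" if "y \<in> S" for y
  proof
    fix i
    show "\<phi> (\<psi> y) i = y i"
    proof (cases "i < n")
      case True
      define z where "z = (y i - p i) / e i"
      have z: "\<bar>z\<bar> < 1" using that True by (simp add: S_def z_def)
      then have "1 + \<bar>z / (1 - \<bar>z\<bar>)\<bar> = 1 / (1 - \<bar>z\<bar>)" by (simp add: field_simps)
      then have "z / (1 - \<bar>z\<bar>) / (1 + \<bar>z / (1 - \<bar>z\<bar>)\<bar>) = z" using z by simp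
      then have "\<phi> (\<psi> y) i = p i + e i * z" using True by (simp add: \<phi>_def \<psi>_def z_def[symmetric])
      then show ?thesis using e(1)[of i] by (simp add: z_def)
    next
      case False
      then show ?thesis using that by (auto simp: S_def \<phi>_def topspace_Euclidean_space)
    qed
  qed
  have coord: "continuous_on A (\<lambda>x::nat \<Rightarrow> real. x i)" for A i
    by (rule continuous_on_subset[OF continuous_on_product_coordinates]) simp
  have "continuous_on (topspace (Euclidean_space n)) (\<lambda>x. \<phi> x i)" for i
    by (cases "i < n") (auto simp: \<phi>_def intro!: continuous_intros coord)
  moreover have "continuous_on S (\<lambda>x. \<psi> x i)" for i
    by (cases "i < n") (auto simp: \<psi>_def S_def intro!: continuous_intros coord simp: e_nz)
  ultimately have "homeomorphic_maps (top_of_set S) (top_of_set (topspace (Euclidean_space n))) \<psi> \<phi>"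
    using \<phi> \<psi> \<psi>\<phi> \<phi>\<psi>
    by (auto simp: homeomorphic_maps_def intro!: continuous_on_coordinatewise_then_product)
  then have "subtopology (Euclidean_space n) S homeomorphic_space Euclidean_space n"
    unfolding sub using Euclidean_space_top_of_set homeomorphic_space_def by metis
  then show ?thesis
    using \<open>S \<subseteq> U\<close> \<open>U \<subseteq> T\<close> unfolding contains_cell_def by blast
qed

section \<open>Bricks from strictly star-shaped sets\<close>

text \<open>
  The set where all the inequalities are strict is open and so lies in the interior.  By strict
  star-shapedness the straight-line homotopy from \<open>G\<close> to the constant \<open>p\<close> stays in this set at all
  times \<open>t > 0\<close>.
\<close>
lemma brick_star_shaped:
  assumes F: "finite F" "\<And>f. f \<in> F \<Longrightarrow> real_polynomial n f"
    and T: "T = {x \<in> topspace (Euclidean_space n). \<forall>f\<in>F. 0 \<le> f x}"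
    and G: "\<And>i. i < n \<Longrightarrow> real_polynomial m (\<lambda>x. G x i)"
    and img: "G ` unit_cball m = T"
    and p: "p \<in> topspace (Euclidean_space n)"
    and star: "\<And>f z t. \<lbrakk>f \<in> F; z \<in> T; 0 < t; t \<le> 1\<rbrakk> \<Longrightarrow> 0 < f (\<lambda>i. (1 - t) * z i + t * p i)"
  shows "brick m n T"
proof -
  define U where "U = topspace (Euclidean_space n) \<inter> (\<Inter>f\<in>F. {x. 0 < f x})"
  have "open (\<Inter>f\<in>F. {x. 0 < f x})"
    using F by (intro open_INT ballI open_Collect_less) (auto intro: real_polynomial_continuous_on)
  then have U: "openin (Euclidean_space n) U"
    unfolding U_def by (subst Euclidean_space_top_of_set) (auto simp: openin_open)
  have "U \<subseteq> T" unfolding U_def T by (auto intro: less_imp_le)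
  have UI: "U \<subseteq> Euclidean_space n interior_of T"
    using U \<open>U \<subseteq> T\<close> by (rule interior_of_maximal[rotated])
  have move: "(\<lambda>i. (1 - t) * z i + t * p i) \<in> U" if "z \<in> T" "0 < t" "t \<le> 1" for z t
    using that star p unfolding U_def T by (auto simp: topspace_Euclidean_space)
  have zero: "(\<lambda>_. 0) \<in> unit_cball m" by (simp add: unit_cball_def topspace_Euclidean_space)
  then have "G (\<lambda>_. 0) \<in> T" using img by blast
  \<comment> \<open>At time \<open>t = 1\<close> every point has moved to \<open>p\<close>.\<close>
  from move[OF this, of 1] have "p \<in> U" by simp
  have semi: "semialgebraic n T"
    unfolding T using F by (rule semialgebraic_basic_closed)
  have dim: "has_dimension n T n"
    unfolding has_dimension_def
    using contains_cell_le contains_cell_openin[OF U \<open>p \<in> U\<close> \<open>U \<subseteq> T\<close>] by blast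
  define H where "H = (\<lambda>(t, x) i. (1 - t) * G x i + t * p i)"
  have H0: "H (0, x) = G x" and H1: "H (1, x) = p" for x by (auto simp: H_def)
  have HU: "H (t, x) \<in> U" if "x \<in> unit_cball m" "0 < t" "t \<le> 1" for t x
    using move[of "G x" t] that img by (auto simp: H_def)
  have HT: "H (t, x) \<in> T" if "x \<in> unit_cball m" "0 \<le> t" "t \<le> 1" for t x
    using HU[of x t] that H0[of x] img \<open>U \<subseteq> T\<close> by (cases "t = 0") auto
  have T_sub: "T \<subseteq> topspace (Euclidean_space n)" unfolding T by auto
  have "continuous_on ({0..1} \<times> unit_cball m) (\<lambda>q. H q i)" for i
  proof (cases "i < n")
    case True
    have "continuous_on ({0..1} \<times> unit_cball m) (\<lambda>q. G (snd q) i)"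
      using continuous_on_compose2[OF real_polynomial_continuous_on[OF G[OF True], of UNIV]
          continuous_on_snd[OF continuous_on_id]] by auto
    then show ?thesis unfolding H_def case_prod_beta by (intro continuous_intros)
  next
    case False
    then have "H q i = 0" if "q \<in> {0..1} \<times> unit_cball m" for q
      using that HT T_sub by (fastforce simp: topspace_Euclidean_space)
    then show ?thesis by (simp cong: continuous_on_cong)
  qed
  then have "continuous_on ({0..1} \<times> unit_cball m) H"
    by (rule continuous_on_coordinatewise_then_product)
  then have cont: "continuous_map
       (prod_topology (top_of_set {0..1}) (subtopology (Euclidean_space m) (unit_cball m)))
       (subtopology (Euclidean_space n) T) H"
  proof -
    have "subtopology (Euclidean_space m) (unit_cball m) = top_of_set (unit_cball m)"
      by (subst Euclidean_space_top_of_set) (auto simp: subtopology_subtopology unit_cball_def inf_absorb2)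
    moreover have "subtopology (Euclidean_space n) T = top_of_set T"
      using T_sub by (subst Euclidean_space_top_of_set) (auto simp: subtopology_subtopology inf_absorb2)
    moreover have "H \<in> {0..1} \<times> unit_cball m \<rightarrow> T" using HT by auto
    ultimately show ?thesis
      using \<open>continuous_on ({0..1} \<times> unit_cball m) H\<close>
      by simp
  qed
  have "brick_homotopy m n T H"
    unfolding brick_homotopy_def
  proof (intro conjI allI impI)
    show "C0_polynomial_on m (unit_cball m) (\<lambda>q. H q i)" if "i < n" for i
      using C0_polynomial_on_homotopy[OF G[OF that], of "unit_cball m" "p i"] by (simp add: H_def case_prod_unfold)
    show "H ` ({0} \<times> unit_cball m) = T"
      using img H0 by (auto simp: image_iff)
    show "\<exists>p. \<forall>x\<in>unit_cball m. H (1, x) = p" using H1 by blast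
    show "\<forall>t\<in>{0<..<1}. H ` ({t} \<times> unit_cball m) \<subseteq> Euclidean_space n interior_of T"
      using HU UI by fastforce
  qed (fact cont)
  with semi dim show ?thesis unfolding brick_def by blast
qed

section \<open>Solids of revolution\<close>

definition axial_sq :: "nat \<Rightarrow> (nat \<Rightarrow> real) \<Rightarrow> real" where
  "axial_sq n x = (\<Sum>i = 1..<n. (x i)\<^sup>2)"

lemma axial_sq_nonneg [simp]: "0 \<le> axial_sq n x"
  by (simp add: axial_sq_def sum_nonneg)

lemma axial_sq_scale:
  assumes "\<And>i. 0 < i \<Longrightarrow> i < n \<Longrightarrow> y i = c * x i"
  shows "axial_sq n y = c\<^sup>2 * axial_sq n x"
  using assms by (auto simp: axial_sq_def sum_distrib_left power_mult_distrib intro!: sum.cong)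

lemma real_polynomial_axial_sq [intro]: "real_polynomial n (\<lambda>x. axial_sq n x)"
  unfolding axial_sq_def by (intro real_polynomial_sum real_polynomial_power real_polynomial_coord) simp

lemma unit_cball_axial:
  assumes "0 < n"
  shows "unit_cball n = {x \<in> topspace (Euclidean_space n). (x 0)\<^sup>2 + axial_sq n x \<le> 1}"
proof -
  have "(\<Sum>i<n. (x i)\<^sup>2) = (x 0)\<^sup>2 + axial_sq n x" for x :: "nat \<Rightarrow> real"
    using assms by (simp add: axial_sq_def lessThan_atLeast0 sum.atLeast_Suc_lessThan)
  then show ?thesis by (simp add: unit_cball_def)
qed

definition axis_pair :: "real \<Rightarrow> real \<Rightarrow> nat \<Rightarrow> real" where
  "axis_pair a b = (\<lambda>i. if i = 0 then a else if i = 1 then b else 0)"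

lemma axis_pair:
  assumes "2 \<le> n"
  shows "axis_pair a b \<in> topspace (Euclidean_space n)" "axial_sq n (axis_pair a b) = b\<^sup>2"
    "axis_pair a b 0 = a"
proof -
  have "axial_sq n (axis_pair a b) = (\<Sum>i = 1..<n. if i = 1 then b\<^sup>2 else 0)"
    unfolding axial_sq_def by (rule sum.cong) (auto simp: axis_pair_def)
  then show "axial_sq n (axis_pair a b) = b\<^sup>2" using assms by simp
qed (use assms in \<open>auto simp: axis_pair_def topspace_Euclidean_space\<close>)

text \<open>
  The point \<open>(a, b u)\<close> has distance \<open>|b|\<close> from the axis, and \<open>P\<close> is symmetric under \<open>b \<mapsto> -b\<close>.  For points
  of the axis itself, any unit vector serves as \<open>u\<close>.
\<close>
lemma rotate_planar_axial:
  assumes n: "2 \<le> n" and P: "P = {(a, b). R a (b\<^sup>2)}"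
  shows "rotate_planar n P = {x \<in> topspace (Euclidean_space n). R (x 0) (axial_sq n x)}"
    (is "_ = ?B")
proof -
  have nn: "Suc (n - 2) = n - 1" using n by simp
  have shift: "axial_sq n (cons_point a v) = (\<Sum>i\<le>n - 2. (v i)\<^sup>2)" for a v
  proof -
    have "axial_sq n (cons_point a v) = (\<Sum>i = Suc 0..<Suc (n - 1). (cons_point a v i)\<^sup>2)"
      using n by (simp add: axial_sq_def)
    also have "\<dots> = (\<Sum>i = 0..<n - 1. (v i)\<^sup>2)"
      unfolding sum.shift_bounds_Suc_ivl by (simp add: cons_point_def)
    also have "{0..<n - 1} = {..n - 2}" using n by auto
    finally show ?thesis .
  qed
  have "x \<in> ?B" if "x \<in> rotate_planar n P" for x
  proof -
    from that
    obtain a b u where x: "x = cons_point a (\<lambda>j. b * u j)" "R a (b\<^sup>2)"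
      and u: "(\<Sum>i\<le>n - 2. (u i)\<^sup>2) = 1" "\<And>i. i \<ge> n - 1 \<Longrightarrow> u i = 0"
      by (auto simp: rotate_planar_def P nsphere_def topspace_Euclidean_space nn)
    have "axial_sq n x = b\<^sup>2"
      unfolding x shift using u by (simp add: power_mult_distrib sum_distrib_left[symmetric])
    moreover have "x i = 0" if "i \<ge> n" for i
      using that n u(2)[of "i - 1"] by (cases i) (simp_all add: x(1) cons_point_def)
    ultimately show ?thesis using x by (auto simp: topspace_Euclidean_space cons_point_def)
  qed
  moreover have "x \<in> rotate_planar n P" if x: "x \<in> ?B" for x
  proof -
    define b where "b = sqrt (axial_sq n x)"
    have b2: "b\<^sup>2 = axial_sq n x" by (simp add: b_def)
    have x_cons: "x = cons_point (x 0) (\<lambda>j. x (Suc j))"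
      by (rule ext) (simp add: cons_point_def split: nat.split)
    define u where "u = (\<lambda>j. if b = 0 then (if j = 0 then 1 else 0) else x (Suc j) / b)"
    have sum_x: "(\<Sum>i\<le>n - 2. (x (Suc i))\<^sup>2) = b\<^sup>2"
      unfolding b2 using shift[of "x 0" "\<lambda>j. x (Suc j)"] unfolding x_cons[symmetric] by simp
    have bu: "b * u j = x (Suc j)" for j
    proof (cases "b = 0")
      case True
      then have "\<forall>i\<in>{..n - 2}. (x (Suc i))\<^sup>2 = 0"
        using sum_x by (subst sum_nonneg_eq_0_iff[symmetric]) auto
      then have "x (Suc j) = 0" if "j \<le> n - 2" using that by simp
      moreover have "x (Suc j) = 0" if "\<not> j \<le> n - 2" using that x by (auto simp: topspace_Euclidean_space)
      ultimately show ?thesis using True by auto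
    qed (simp add: u_def)
    have "(\<Sum>i\<le>n - 2. (u i)\<^sup>2) = 1"
    proof (cases "b = 0")
      case True
      then have "(\<Sum>i\<le>n - 2. (u i)\<^sup>2) = (\<Sum>i\<le>n - 2. if i = 0 then 1 else 0)"
        by (intro sum.cong) (auto simp: u_def)
      then show ?thesis by simp
    next
      case False
      then show ?thesis using sum_x by (simp add: u_def power_divide sum_divide_distrib[symmetric])
    qed
    moreover have "u i = 0" if "i \<ge> n - 1" for i
      using that n x by (auto simp: u_def topspace_Euclidean_space)
    ultimately have "u \<in> topspace (nsphere (n - 2))"
      by (auto simp: nsphere_def topspace_Euclidean_space nn)
    moreover have "(x 0, b) \<in> P" using x b2 by (simp add: P)
    moreover have "x = cons_point (x 0) (\<lambda>j. b * u j)" unfolding bu by (rule x_cons)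
    ultimately show ?thesis unfolding rotate_planar_def by blast
  qed
  ultimately show ?thesis by blast
qed

text \<open>
  The map commutes with rotations about the axis, so its image is determined by its behaviour
  on a half-plane: the radius \<open>y\<close> goes to \<open>y Q\<close> and the direction orthogonal to the axis is kept or
  reversed.  A preimage of \<open>z\<close> is found by rescaling the part of \<open>z\<close> orthogonal to the axis, or, if
  that part vanishes, in an arbitrary direction.
\<close>
lemma axial_map_image:
  fixes P Q :: "real \<Rightarrow> real \<Rightarrow> real"
  assumes n: "2 \<le> n"
    and into: "\<And>x y. x\<^sup>2 + y\<^sup>2 \<le> 1 \<Longrightarrow> R (P x (y\<^sup>2)) ((y * Q x (y\<^sup>2))\<^sup>2)"
    and onto: "\<And>a b. \<lbrakk>0 \<le> b; R a (b\<^sup>2)\<rbrakk> \<Longrightarrow>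
                 \<exists>x y. x\<^sup>2 + y\<^sup>2 \<le> 1 \<and> P x (y\<^sup>2) = a \<and> y * Q x (y\<^sup>2) = b"
  defines "G \<equiv> \<lambda>x i. if i = 0 then P (x 0) (axial_sq n x) else x i * Q (x 0) (axial_sq n x)"
  shows "G ` unit_cball n = {z \<in> topspace (Euclidean_space n). R (z 0) (axial_sq n z)}"
proof (intro equalityI subsetI)
  have ball: "unit_cball n = {x \<in> topspace (Euclidean_space n). (x 0)\<^sup>2 + axial_sq n x \<le> 1}"
    using n by (intro unit_cball_axial) simp
  have G_sq: "axial_sq n (G x) = (Q (x 0) (axial_sq n x))\<^sup>2 * axial_sq n x" for x
    by (rule axial_sq_scale) (simp add: G_def)
  fix z
  {
    assume "z \<in> G ` unit_cball n"
    then obtain x where x: "z = G x" "x \<in> topspace (Euclidean_space n)" "(x 0)\<^sup>2 + axial_sq n x \<le> 1"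
      by (auto simp: ball)
    with into[of "x 0" "sqrt (axial_sq n x)"] have "R (z 0) (axial_sq n z)"
      unfolding \<open>z = G x\<close> G_sq by (simp add: power_mult_distrib mult.commute) (simp add: G_def)
    then show "z \<in> {z \<in> topspace (Euclidean_space n). R (z 0) (axial_sq n z)}"
      using x n by (auto simp: G_def topspace_Euclidean_space)
  }
  assume z: "z \<in> {z \<in> topspace (Euclidean_space n). R (z 0) (axial_sq n z)}"
  define b where "b = sqrt (axial_sq n z)"
  have b: "0 \<le> b" "b\<^sup>2 = axial_sq n z" by (simp_all add: b_def)
  with onto[of b "z 0"] z obtain x y where xy: "x\<^sup>2 + y\<^sup>2 \<le> 1" "P x (y\<^sup>2) = z 0" "y * Q x (y\<^sup>2) = b"
    by auto
  show "z \<in> G ` unit_cball n"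
  proof (cases "b = 0")
    case True
    have z0: "z i = 0" if "0 < i" for i
    proof (cases "i < n")
      case True
      have "(\<Sum>i = 1..<n. (z i)\<^sup>2) = 0" using \<open>b = 0\<close> b by (simp add: axial_sq_def)
      then have "\<forall>i\<in>{1..<n}. (z i)\<^sup>2 = 0" by (subst sum_nonneg_eq_0_iff[symmetric]) auto
      then show ?thesis using True that by simp
    qed (use z in \<open>auto simp: topspace_Euclidean_space\<close>)
    have "G (axis_pair x y) = z"
      unfolding G_def axis_pair[OF n] using xy True z0
      by (auto simp: axis_pair_def fun_eq_iff)
    moreover have "axis_pair x y \<in> unit_cball n" using xy axis_pair[OF n] by (simp add: ball)
    ultimately show ?thesis by blast
  next
    case False
    define x' where "x' = (\<lambda>i. if i = 0 then x else y / b * z i)"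
    have "axial_sq n x' = (y / b)\<^sup>2 * axial_sq n z"
      by (rule axial_sq_scale) (simp add: x'_def)
    then have sq: "axial_sq n x' = y\<^sup>2" unfolding b(2)[symmetric] using False by (simp add: power_divide)
    have "x' i * Q x (y\<^sup>2) = z i" if "i \<noteq> 0" for i
    proof -
      have "x' i * Q x (y\<^sup>2) = (y * Q x (y\<^sup>2)) / b * z i" using that by (simp add: x'_def)
      then show ?thesis using False xy by simp
    qed
    then have "G x' = z" unfolding G_def sq using xy by (auto simp: x'_def fun_eq_iff)
    moreover have "x' \<in> unit_cball n"
      using xy n z by (auto simp: ball sq topspace_Euclidean_space) (auto simp: x'_def)
    ultimately show ?thesis by blast
  qed
qed

text \<open>
  The polynomials \<open>P\<close> and \<open>Q\<close> are functions of \<open>x\<close> and of \<open>y\<^sup>2\<close>; the map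
  \<open>(x, y) \<mapsto> (P x y\<^sup>2, y Q x y\<^sup>2)\<close> takes the unit disc into the planar set given by \<open>R\<close> and covers the part
  of it in the upper half-plane.  They are to give polynomials in every dimension, so that one planar
  construction serves all \<open>n\<close>.
\<close>
definition axial_parametrization ::
    "(real \<Rightarrow> real \<Rightarrow> bool) \<Rightarrow> (real \<Rightarrow> real \<Rightarrow> real) \<Rightarrow> (real \<Rightarrow> real \<Rightarrow> real) \<Rightarrow> bool" where
  "axial_parametrization R P Q \<longleftrightarrow>
     (\<forall>n>0. real_polynomial n (\<lambda>x. P (x 0) (axial_sq n x)) \<and>
            real_polynomial n (\<lambda>x. Q (x 0) (axial_sq n x))) \<and>
     (\<forall>x y. x\<^sup>2 + y\<^sup>2 \<le> 1 \<longrightarrow> R (P x (y\<^sup>2)) ((y * Q x (y\<^sup>2))\<^sup>2)) \<and>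
     (\<forall>a b. 0 \<le> b \<and> R a (b\<^sup>2) \<longrightarrow>
        (\<exists>x y. x\<^sup>2 + y\<^sup>2 \<le> 1 \<and> P x (y\<^sup>2) = a \<and> y * Q x (y\<^sup>2) = b))"

text \<open>
  By symmetry, everything can be checked on the profile: moving a point towards the point at position \<open>p\<close> of
  the axis by the fraction \<open>t\<close> multiplies its squared radius by \<open>(1 - t)\<^sup>2\<close>.
\<close>
lemma brick_of_revolution:
  fixes P Q :: "real \<Rightarrow> real \<Rightarrow> real"
  assumes n: "2 \<le> n"
    and F: "finite F" "\<And>f. f \<in> F \<Longrightarrow> real_polynomial n (\<lambda>x. f (x 0) (axial_sq n x))"
    and R: "\<And>a \<beta>. R a \<beta> \<longleftrightarrow> (\<forall>f\<in>F. 0 \<le> f a \<beta>)"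
    and PQ: "axial_parametrization R P Q"
    and star: "\<And>f a \<beta> t. \<lbrakk>f \<in> F; 0 \<le> \<beta>; R a \<beta>; 0 < t; t \<le> 1\<rbrakk> \<Longrightarrow>
                 0 < f ((1 - t) * a + t * p) ((1 - t)\<^sup>2 * \<beta>)"
  shows "brick n n (rotate_planar n {(a, b). R a (b\<^sup>2)})"
proof -
  define G where "G = (\<lambda>x i. if i = 0 then P (x 0) (axial_sq n x) else x i * Q (x 0) (axial_sq n x))"
  have img: "G ` unit_cball n = {x \<in> topspace (Euclidean_space n). R (x 0) (axial_sq n x)}"
    using PQ unfolding G_def axial_parametrization_def by (intro axial_map_image[OF n]) blast+
  show ?thesis
    unfolding rotate_planar_axial[OF n refl]
  proof (rule brick_star_shaped[where F = "(\<lambda>f x. f (x 0) (axial_sq n x)) ` F" and G = G and p = "axis_pair p 0"])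
    show "{x \<in> topspace (Euclidean_space n). R (x 0) (axial_sq n x)} =
      {x \<in> topspace (Euclidean_space n). \<forall>f\<in>(\<lambda>f x. f (x 0) (axial_sq n x)) ` F. 0 \<le> f x}"
      by (simp add: R)
    show "real_polynomial n (\<lambda>x. G x i)" if "i < n" for i
      using PQ n that by (cases "i = 0") (auto simp: G_def axial_parametrization_def)
    show "0 < f (\<lambda>i. (1 - t) * z i + t * axis_pair p 0 i)"
      if "f \<in> (\<lambda>f x. f (x 0) (axial_sq n x)) ` F" "0 < t" "t \<le> 1"
        "z \<in> {x \<in> topspace (Euclidean_space n). R (x 0) (axial_sq n x)}" for f z t
    proof -
      have "axial_sq n (\<lambda>i. (1 - t) * z i + t * axis_pair p 0 i) = (1 - t)\<^sup>2 * axial_sq n z"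
        by (rule axial_sq_scale) (simp add: axis_pair_def)
      then show ?thesis using that star by (auto simp: axis_pair_def)
    qed
  qed (use F img axis_pair[OF n] in auto)
qed

section \<open>From the ball to the cylinder\<close>

text \<open>
  With \<open>x = sin \<phi>\<close> the first expression is \<open>(sin 2\<phi>)\<^sup>2\<close>, and with \<open>y = sin \<psi>\<close> the second one is
  \<open>(sin 3\<psi>)\<^sup>2\<close>.
\<close>
lemma ball_to_cylinder:
  fixes x y :: real
  assumes "x\<^sup>2 + y\<^sup>2 \<le> 1"
  shows "4 * x\<^sup>2 * (1 - x\<^sup>2) \<in> {0..1}" "(y * (3 - 4 * y\<^sup>2))\<^sup>2 \<le> 1"
proof -
  have le: "x\<^sup>2 \<le> 1" "y\<^sup>2 \<le> 1" using assms zero_le_power2[of x] zero_le_power2[of y] by linarith+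
  have "4 * x\<^sup>2 * (1 - x\<^sup>2) = 1 - (2 * x\<^sup>2 - 1)\<^sup>2" by (simp add: power2_eq_square algebra_simps)
  moreover have "0 \<le> 4 * x\<^sup>2 * (1 - x\<^sup>2)" using le by simp
  ultimately show "4 * x\<^sup>2 * (1 - x\<^sup>2) \<in> {0..1}"
    unfolding atLeastAtMost_iff using zero_le_power2[of "2 * x\<^sup>2 - 1"] by argo
  have "(y * (3 - 4 * y\<^sup>2))\<^sup>2 = 1 - (1 - y\<^sup>2) * (1 - 4 * y\<^sup>2)\<^sup>2"
    by (simp add: power2_eq_square algebra_simps)
  then show "(y * (3 - 4 * y\<^sup>2))\<^sup>2 \<le> 1" using le by simp
qed

text \<open>
  Both functions run through their full range already on \<open>x\<^sup>2 \<le> 1/2\<close> and \<open>0 \<le> y \<le> 1/2\<close>, and these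
  bounds imply \<open>x\<^sup>2 + y\<^sup>2 \<le> 3/4\<close>.  This slack is what lets a ball cover a cylinder with its edges.
\<close>
lemma cylinder_from_ball:
  fixes s w :: real
  assumes "s \<in> {0..1}" "w \<in> {0..1}"
  obtains x y where "x\<^sup>2 + y\<^sup>2 \<le> 1" "4 * x\<^sup>2 * (1 - x\<^sup>2) = s" "y * (3 - 4 * y\<^sup>2) = w"
proof -
  \<comment> \<open>The smaller root \<open>x\<^sup>2\<close> of \<open>4 x\<^sup>2 (1 - x\<^sup>2) = s\<close>.\<close>
  define x where "x = sqrt ((1 - sqrt (1 - s)) / 2)"
  have x2: "x\<^sup>2 = (1 - sqrt (1 - s)) / 2" using assms by (simp add: x_def)
  have "4 * x\<^sup>2 * (1 - x\<^sup>2) = 1 - (sqrt (1 - s))\<^sup>2" unfolding x2 by (simp add: field_simps power2_eq_square)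
  then have x: "4 * x\<^sup>2 * (1 - x\<^sup>2) = s" using assms by simp
  have "\<exists>y\<ge>0. y \<le> 1/2 \<and> y * (3 - 4 * y\<^sup>2) = w"
    using assms by (intro IVT') (auto intro!: continuous_intros simp: power2_eq_square)
  then obtain y where y: "0 \<le> y" "y \<le> 1/2" "y * (3 - 4 * y\<^sup>2) = w" by auto
  have "y\<^sup>2 \<le> (1/2)\<^sup>2" using y by (intro power_mono)
  moreover have "0 \<le> sqrt (1 - s)" using assms by simp
  moreover have "(1/2)\<^sup>2 = (1/4 :: real)" by (simp add: power_divide)
  ultimately have "x\<^sup>2 + y\<^sup>2 \<le> 1" unfolding x2 by argo
  with x y that show thesis by blast
qed

section \<open>The bump polynomial\<close>

text \<open>
  Weighted arithmetic-geometric mean: the left-hand side is the product of \<open>(2k + 1) q\<close> and \<open>2k\<close> copies of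
  \<open>(2k + 1) (1 - q) / (2k)\<close>, which have arithmetic mean \<open>1\<close>.  The proof uses \<open>x \<le> exp (x - 1)\<close> for each
  factor.
\<close>
lemma bump_le_one:
  fixes q :: real and k :: nat
  assumes "0 < k" "0 \<le> q" "q \<le> 1"
  defines "c \<equiv> sqrt (2 * k + 1) * ((2 * k + 1) / (2 * k)) ^ k"
  shows "q * (c * (1 - q) ^ k)\<^sup>2 \<le> 1"
proof -
  let ?p = "(2 * k + 1) * q" and ?r = "(2 * k + 1) / (2 * k) * (1 - q)"
  have c2: "(c * (1 - q) ^ k)\<^sup>2 = (2 * k + 1) * ?r ^ (2 * k)"
    unfolding c_def power_mult_distrib by (simp add: power_mult[symmetric] power_mult_distrib[symmetric] mult.commute mult.left_commute)
  have "?p \<le> exp (?p - 1)" using exp_ge_add_one_self[of "?p - 1"] by simp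
  moreover have "?r ^ (2 * k) \<le> exp (?r - 1) ^ (2 * k)"
    using exp_ge_add_one_self[of "?r - 1"] assms by (intro power_mono) auto
  ultimately have "?p * ?r ^ (2 * k) \<le> exp (?p - 1) * exp (?r - 1) ^ (2 * k)"
    using assms by (intro mult_mono) auto
  also have "\<dots> = exp ((?p - 1) + (2 * k) * (?r - 1))"
    by (simp only: exp_add exp_of_nat_mult)
  also have "(?p - 1) + (2 * k) * (?r - 1) = 0"
    using assms by (simp add: field_simps)
  finally show ?thesis unfolding c2 by (simp add: algebra_simps)
qed

text \<open>
  Put \<open>\<lambda>(q) = c (1 - q)\<^sup>k\<close>.  The bump \<open>u \<lambda>(u\<^sup>2)\<close> is bounded by \<open>1\<close> on \<open>[0,1]\<close>, and this is stated for the
  squares, in terms of \<open>q = u\<^sup>2\<close>, because only \<open>q\<close> is polynomial in the applications.  It attains \<open>1\<close> at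
  \<open>u\<^sub>0 = 1 / sqrt (2k + 1)\<close>, which is at most \<open>\<delta>\<close> for large \<open>k\<close>; the intermediate value theorem on
  \<open>[0, u\<^sub>0]\<close> gives the other values.
\<close>
lemma bump_exists:
  fixes \<delta> :: real
  assumes "0 < \<delta>"
  obtains k c where
    "0 \<le> c"
    "\<And>q. \<lbrakk>0 \<le> q; q \<le> 1\<rbrakk> \<Longrightarrow> q * (c * (1 - q) ^ k)\<^sup>2 \<le> 1"
    "\<And>U h. \<lbrakk>\<delta> \<le> U; 0 \<le> h; h \<le> 1\<rbrakk> \<Longrightarrow> \<exists>u. 0 \<le> u \<and> u \<le> U \<and> u * (c * (1 - u\<^sup>2) ^ k) = h"
proof -
  obtain k :: nat where k: "1 / \<delta>\<^sup>2 < k" using reals_Archimedean2 by blast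
  with assms have "0 < k" by (cases "k = 0") (auto simp: not_less[symmetric])
  define N :: real where "N = 2 * k + 1"
  define c where "c = sqrt N * (N / (2 * k)) ^ k"
  have N: "0 < N" by (simp add: N_def)
  have "1 \<le> N * \<delta>\<^sup>2"
  proof -
    have "1 < k * \<delta>\<^sup>2" using k assms by (simp add: pos_divide_less_eq)
    moreover have "N * \<delta>\<^sup>2 = 2 * (k * \<delta>\<^sup>2) + \<delta>\<^sup>2" unfolding N_def by (simp add: algebra_simps)
    ultimately show ?thesis using zero_le_power2[of \<delta>] by linarith
  qed
  then have "1 / N \<le> \<delta>\<^sup>2" using N by (simp add: pos_divide_le_eq mult.commute)
  define u0 where "u0 = 1 / sqrt N"
  have u02: "u0\<^sup>2 = 1 / N" using N by (simp add: u0_def power_divide)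
  have "u0\<^sup>2 \<le> \<delta>\<^sup>2" unfolding u02 by fact
  then have "u0 \<le> \<delta>" by (rule power2_le_imp_le) (use assms in simp)
  have u0: "u0 * (c * (1 - u0\<^sup>2) ^ k) = 1"
  proof -
    have "1 - u0\<^sup>2 = (2 * k) / N" unfolding u02 using N by (simp add: N_def field_simps)
    then have "(N / (2 * k)) ^ k * (1 - u0\<^sup>2) ^ k = 1"
      using \<open>0 < k\<close> N by (simp add: power_mult_distrib[symmetric])
    then have "c * (1 - u0\<^sup>2) ^ k = sqrt N" by (simp add: c_def mult.assoc)
    then show ?thesis using N by (simp add: u0_def)
  qed
  show thesis
  proof
    show "0 \<le> c" using N by (simp add: c_def)
    show "q * (c * (1 - q) ^ k)\<^sup>2 \<le> 1" if "0 \<le> q" "q \<le> 1" for q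
      using bump_le_one[OF \<open>0 < k\<close> that] by (simp add: c_def N_def)
    show "\<exists>u. 0 \<le> u \<and> u \<le> U \<and> u * (c * (1 - u\<^sup>2) ^ k) = h" if "\<delta> \<le> U" "0 \<le> h" "h \<le> 1" for U h
    proof -
      have "\<exists>u\<ge>0. u \<le> u0 \<and> u * (c * (1 - u\<^sup>2) ^ k) = h"
        using that u0 N by (intro IVT') (auto intro!: continuous_intros simp: u0_def)
      then show ?thesis using order_trans[OF \<open>u0 \<le> \<delta>\<close> \<open>\<delta> \<le> U\<close>] order_trans by blast
    qed
  qed
qed

section \<open>The planar sector and segment in Cartesian coordinates\<close>

text \<open>
  The argument \<open>\<beta>\<close> is the square of the distance from the axis.  The inequalities have the shape
  \<open>0 \<le> f a \<beta>\<close> that is needed for a basic closed semialgebraic set.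
\<close>
definition hyp_sector_profile :: "real \<Rightarrow> real \<Rightarrow> real \<Rightarrow> bool" where
  "hyp_sector_profile \<tau> a \<beta> \<longleftrightarrow> 0 \<le> a \<and> 0 \<le> \<tau>\<^sup>2 * a\<^sup>2 - \<beta> \<and> 0 \<le> 1 - (a\<^sup>2 - \<beta>)"

definition hyp_segment_profile :: "real \<Rightarrow> real \<Rightarrow> real \<Rightarrow> bool" where
  "hyp_segment_profile A a \<beta> \<longleftrightarrow> 0 \<le> a \<and> 0 \<le> a\<^sup>2 - \<beta> - 1 \<and> 0 \<le> A - a"

text \<open>
  Away from the apex the polar angle is \<open>arctan (b / a)\<close>.
\<close>
lemma polar_wedge:
  fixes a b \<alpha> :: real
  assumes "0 < \<alpha>" "\<alpha> < pi / 2" "0 \<le> a"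
  shows "b\<^sup>2 \<le> (tan \<alpha>)\<^sup>2 * a\<^sup>2 \<longleftrightarrow>
    (\<exists>\<rho> \<theta>. 0 \<le> \<rho> \<and> -\<alpha> \<le> \<theta> \<and> \<theta> \<le> \<alpha> \<and> a = \<rho> * cos \<theta> \<and> b = \<rho> * sin \<theta>)"
proof
  have tpos: "0 < tan \<alpha>" using assms by (simp add: tan_gt_zero)
  assume L: "b\<^sup>2 \<le> (tan \<alpha>)\<^sup>2 * a\<^sup>2"
  show "\<exists>\<rho> \<theta>. 0 \<le> \<rho> \<and> -\<alpha> \<le> \<theta> \<and> \<theta> \<le> \<alpha> \<and> a = \<rho> * cos \<theta> \<and> b = \<rho> * sin \<theta>"
  proof (cases "a = 0")
    case True
    with L have "b = 0" by simp
    then show ?thesis using True assms by (intro exI[of _ 0]) auto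
  next
    case False
    define \<theta> where "\<theta> = arctan (b / a)"
    have "\<bar>b\<bar> \<le> tan \<alpha> * a" using L tpos assms
      by (metis abs_le_square_iff abs_of_nonneg less_imp_le mult_nonneg_nonneg power_mult_distrib)
    then have "- tan \<alpha> * a \<le> b" "b \<le> tan \<alpha> * a" by auto
    then have "- tan \<alpha> \<le> b / a" "b / a \<le> tan \<alpha>"
      using False assms pos_le_divide_eq[of a] pos_divide_le_eq[of a] by auto
    then have "arctan (- tan \<alpha>) \<le> \<theta>" "\<theta> \<le> arctan (tan \<alpha>)"
      unfolding \<theta>_def by (simp_all only: arctan_le_iff)
    then have th: "- \<alpha> \<le> \<theta>" "\<theta> \<le> \<alpha>"
      using assms by (simp_all add: arctan_minus arctan_tan)
    have c: "0 < cos \<theta>" unfolding \<theta>_def by (rule cos_gt_zero_pi) (rule arctan_lbound, rule arctan_ubound)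
    have "sin \<theta> / cos \<theta> = b / a" using tan_arctan[of "b / a"] by (simp add: \<theta>_def tan_def)
    then have "a / cos \<theta> * sin \<theta> = b" using c False by (simp add: field_simps)
    then show ?thesis using th c assms by (intro exI[of _ "a / cos \<theta>"] exI[of _ \<theta>]) auto
  qed
next
  assume "\<exists>\<rho> \<theta>. 0 \<le> \<rho> \<and> -\<alpha> \<le> \<theta> \<and> \<theta> \<le> \<alpha> \<and> a = \<rho> * cos \<theta> \<and> b = \<rho> * sin \<theta>"
  then obtain \<rho> \<theta> where *: "0 \<le> \<rho>" "-\<alpha> \<le> \<theta>" "\<theta> \<le> \<alpha>" "a = \<rho> * cos \<theta>" "b = \<rho> * sin \<theta>" by blast
  have c: "0 < cos \<theta>" using * assms by (intro cos_gt_zero_pi) auto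
  have "tan (- \<alpha>) \<le> tan \<theta>" "tan \<theta> \<le> tan \<alpha>"
    using * assms by (intro tan_mono_le; simp)+
  then have "\<bar>tan \<theta>\<bar> \<le> \<bar>tan \<alpha>\<bar>" by auto
  then have "(tan \<theta>)\<^sup>2 \<le> (tan \<alpha>)\<^sup>2" by (simp add: abs_le_square_iff)
  then have "(tan \<theta>)\<^sup>2 * a\<^sup>2 \<le> (tan \<alpha>)\<^sup>2 * a\<^sup>2" by (simp add: mult_right_mono)
  moreover have "b = tan \<theta> * a" using * c by (simp add: tan_def)
  ultimately show "b\<^sup>2 \<le> (tan \<alpha>)\<^sup>2 * a\<^sup>2" by (simp add: power_mult_distrib)
qed

lemma hyp_polar:
  fixes \<rho> \<theta> :: real
  shows "\<rho>\<^sup>2 * cos (2 * \<theta>) = (\<rho> * cos \<theta>)\<^sup>2 - (\<rho> * sin \<theta>)\<^sup>2"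
  by (simp add: cos_double power_mult_distrib right_diff_distrib)

lemma planar_hyp_sector_profile:
  assumes "0 < \<alpha>" "\<alpha> < pi / 4"
  shows "planar_hyp_sector \<alpha> = {(a, b). hyp_sector_profile (tan \<alpha>) a (b\<^sup>2)}"
proof -
  have "(a, b) \<in> planar_hyp_sector \<alpha> \<longleftrightarrow> hyp_sector_profile (tan \<alpha>) a (b\<^sup>2)" for a b
  proof -
    have "(a, b) \<in> planar_hyp_sector \<alpha> \<longleftrightarrow>
      0 \<le> a \<and> (\<exists>\<rho> \<theta>. 0 \<le> \<rho> \<and> -\<alpha> \<le> \<theta> \<and> \<theta> \<le> \<alpha> \<and> a = \<rho> * cos \<theta> \<and> b = \<rho> * sin \<theta>) \<and> a\<^sup>2 - b\<^sup>2 \<le> 1"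
      (is "?l \<longleftrightarrow> ?r")
    proof
      assume ?l
      then obtain \<rho> \<theta> where *: "0 \<le> \<rho>" "-\<alpha> \<le> \<theta>" "\<theta> \<le> \<alpha>" "a = \<rho> * cos \<theta>" "b = \<rho> * sin \<theta>"
        "\<rho>\<^sup>2 * cos (2 * \<theta>) \<le> 1" by (auto simp: planar_hyp_sector_def)
      moreover have "0 \<le> cos \<theta>" using * assms by (intro cos_ge_zero) auto
      ultimately show ?r by (auto simp: hyp_polar)
    next
      assume ?r
      then obtain \<rho> \<theta> where *: "0 \<le> \<rho>" "-\<alpha> \<le> \<theta>" "\<theta> \<le> \<alpha>" "a = \<rho> * cos \<theta>" "b = \<rho> * sin \<theta>"
        "\<rho>\<^sup>2 * cos (2 * \<theta>) \<le> 1" by (auto simp: hyp_polar)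
      moreover have "- pi < \<theta>" "\<theta> \<le> pi" using * assms by auto
      ultimately show ?l unfolding planar_hyp_sector_def by blast
    qed
    also have "\<dots> \<longleftrightarrow> hyp_sector_profile (tan \<alpha>) a (b\<^sup>2)"
      using polar_wedge[of \<alpha> a b] assms by (auto simp: hyp_sector_profile_def)
    finally show ?thesis .
  qed
  then show ?thesis by auto
qed

text \<open>
  Dividing by \<open>cos \<theta> > 0\<close> and squaring turns the lower bound for \<open>\<rho> cos \<theta>\<close> into \<open>1 \<le> a\<^sup>2 - b\<^sup>2\<close>.  The
  condition \<open>|\<theta>| \<le> \<alpha>\<close> then follows from \<open>a \<le> A\<close>, as the hyperbola meets the line \<open>a = A\<close> exactly on the
  two rays at angle \<open>\<plusminus>\<alpha>\<close>; algebraically, \<open>A\<^sup>2 (1 - tan\<^sup>2 \<alpha>) = 1\<close>.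
\<close>
lemma planar_hyp_segment_profile:
  assumes "0 < \<alpha>" "\<alpha> < pi / 4"
  defines "A \<equiv> cos \<alpha> / sqrt (cos (2 * \<alpha>))"
  shows "planar_hyp_segment \<alpha> = {(a, b). hyp_segment_profile A a (b\<^sup>2)}"
proof -
  have cpos: "0 < cos (2 * \<theta>)" "0 < cos \<theta>" if "-\<alpha> \<le> \<theta>" "\<theta> \<le> \<alpha>" for \<theta>
    using that assms by (auto intro!: cos_gt_zero_pi)
  have c\<alpha>: "0 < cos (2 * \<alpha>)" "0 < cos \<alpha>" using cpos[of \<alpha>] assms by auto
  have "(cos \<alpha>)\<^sup>2 * (1 - (tan \<alpha>)\<^sup>2) = cos (2 * \<alpha>)"
    using c\<alpha> by (simp add: cos_double tan_def power_divide right_diff_distrib)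
  moreover have "A\<^sup>2 = (cos \<alpha>)\<^sup>2 / cos (2 * \<alpha>)" using c\<alpha> by (simp add: A_def power_divide)
  ultimately have A: "0 < A" "A\<^sup>2 * (1 - (tan \<alpha>)\<^sup>2) = 1" using c\<alpha> by (simp_all add: A_def)
  have hyp: "cos \<theta> / sqrt (cos (2 * \<theta>)) \<le> \<rho> * cos \<theta> \<longleftrightarrow> 1 \<le> \<rho>\<^sup>2 * cos (2 * \<theta>)"
    if "-\<alpha> \<le> \<theta>" "\<theta> \<le> \<alpha>" "0 \<le> \<rho>" for \<rho> \<theta>
  proof -
    have "cos \<theta> / sqrt (cos (2 * \<theta>)) \<le> \<rho> * cos \<theta> \<longleftrightarrow> 1 \<le> \<rho> * sqrt (cos (2 * \<theta>))"
      using cpos[OF that(1,2)] by (simp add: field_simps)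
    also have "\<dots> \<longleftrightarrow> 1\<^sup>2 \<le> (\<rho> * sqrt (cos (2 * \<theta>)))\<^sup>2"
      using cpos[OF that(1,2)] that by (intro power_mono_iff[symmetric]) auto
    finally show ?thesis using cpos[OF that(1,2)] by (simp add: power_mult_distrib)
  qed
  have "(a, b) \<in> planar_hyp_segment \<alpha> \<longleftrightarrow> hyp_segment_profile A a (b\<^sup>2)" for a b
  proof -
    have "(a, b) \<in> planar_hyp_segment \<alpha> \<longleftrightarrow>
      0 \<le> a \<and> (\<exists>\<rho> \<theta>. 0 \<le> \<rho> \<and> -\<alpha> \<le> \<theta> \<and> \<theta> \<le> \<alpha> \<and> a = \<rho> * cos \<theta> \<and> b = \<rho> * sin \<theta>)
        \<and> 1 \<le> a\<^sup>2 - b\<^sup>2 \<and> a \<le> A"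
      (is "?l \<longleftrightarrow> ?r")
    proof
      assume ?l
      then obtain \<rho> \<theta> where *: "0 \<le> \<rho>" "-\<alpha> \<le> \<theta>" "\<theta> \<le> \<alpha>" "a = \<rho> * cos \<theta>" "b = \<rho> * sin \<theta>"
        "cos \<theta> / sqrt (cos (2 * \<theta>)) \<le> \<rho> * cos \<theta>" "\<rho> * cos \<theta> \<le> A"
        by (auto simp: planar_hyp_segment_def A_def)
      moreover have "0 \<le> a" using * cpos(2)[of \<theta>] by simp
      ultimately show ?r using hyp[of \<theta> \<rho>] unfolding hyp_polar by blast
    next
      assume ?r
      then obtain \<rho> \<theta> where *: "0 \<le> \<rho>" "-\<alpha> \<le> \<theta>" "\<theta> \<le> \<alpha>" "a = \<rho> * cos \<theta>" "b = \<rho> * sin \<theta>"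
        "1 \<le> \<rho>\<^sup>2 * cos (2 * \<theta>)" "\<rho> * cos \<theta> \<le> A" by (auto simp: hyp_polar)
      moreover have "- pi < \<theta>" "\<theta> \<le> pi" using * assms by auto
      ultimately show ?l using hyp[of \<theta> \<rho>] unfolding planar_hyp_segment_def A_def by blast
    qed
    also have "\<dots> \<longleftrightarrow> 0 \<le> a \<and> b\<^sup>2 \<le> (tan \<alpha>)\<^sup>2 * a\<^sup>2 \<and> 1 \<le> a\<^sup>2 - b\<^sup>2 \<and> a \<le> A"
      using polar_wedge[of \<alpha> a b] assms by auto
    also have "\<dots> \<longleftrightarrow> hyp_segment_profile A a (b\<^sup>2)"
    proof -
      have "b\<^sup>2 \<le> (tan \<alpha>)\<^sup>2 * a\<^sup>2" if "0 \<le> a" "1 \<le> a\<^sup>2 - b\<^sup>2" "a \<le> A"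
      proof -
        have "a\<^sup>2 \<le> A\<^sup>2" using that by (intro power_mono) auto
        moreover have "0 \<le> 1 - (tan \<alpha>)\<^sup>2"
          using A by (metis less_eq_real_def mult_less_0_iff not_less zero_less_one zero_less_power)
        ultimately have "a\<^sup>2 * (1 - (tan \<alpha>)\<^sup>2) \<le> 1" using A(2) by (metis mult_right_mono)
        then show ?thesis using that by (simp add: algebra_simps)
      qed
      then show ?thesis by (auto simp: hyp_segment_profile_def)
    qed
    finally show ?thesis .
  qed
  then show ?thesis by auto
qed

section \<open>Polynomial parametrizations of the sector and the segment\<close>

text \<open>
  The cylinder point \<open>(s, w)\<close> goes to the point \<open>(s, \<tau> s w)\<close> of the wedge, and this point is multiplied by
  \<open>\<lambda>(q)\<close>, where \<open>q = s\<^sup>2 (1 - \<tau>\<^sup>2 w\<^sup>2)\<close> is its value under the form \<open>a\<^sup>2 - b\<^sup>2\<close> and \<open>\<lambda>(q) = c (1 - q)\<^sup>k\<close>.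
  The form takes the value \<open>q \<lambda>(q)\<^sup>2 \<le> 1\<close> at the new point, so rays through the apex are folded at the
  hyperbola.  On the ray of slope \<open>\<sigma>\<close> the quantity \<open>u = sqrt q\<close> runs up to \<open>sqrt (1 - \<sigma>\<^sup>2)\<close>.  As
  \<open>\<sigma> \<le> \<tau> < 1\<close>, this is at least \<open>\<delta> = sqrt (1 - \<tau>\<^sup>2)\<close>, so every ray is covered up to the hyperbola.
\<close>
lemma hyp_sector_parametrization:
  fixes \<tau> :: real
  assumes "0 < \<tau>" "\<tau> < 1"
  shows "\<exists>P Q. axial_parametrization (hyp_sector_profile \<tau>) P Q"
proof -
  define \<delta> where "\<delta> = sqrt (1 - \<tau>\<^sup>2)"
  have t2: "\<tau>\<^sup>2 < 1" using assms by (simp add: power_less_one_iff)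
  then have "0 < \<delta>" by (simp add: \<delta>_def)
  from bump_exists[OF this] obtain k c where c: "0 \<le> c"
    and le1: "\<And>q. \<lbrakk>0 \<le> q; q \<le> 1\<rbrakk> \<Longrightarrow> q * (c * (1 - q) ^ k)\<^sup>2 \<le> 1"
    and onto: "\<And>U h. \<lbrakk>\<delta> \<le> U; 0 \<le> h; h \<le> 1\<rbrakk> \<Longrightarrow> \<exists>u. 0 \<le> u \<and> u \<le> U \<and> u * (c * (1 - u\<^sup>2) ^ k) = h"
    by metis
  define s :: "real \<Rightarrow> real" where "s = (\<lambda>x. 4 * x\<^sup>2 * (1 - x\<^sup>2))"
  define m :: "real \<Rightarrow> real" where "m = (\<lambda>Y. 3 - 4 * Y)"
  define q where "q = (\<lambda>x Y. (s x)\<^sup>2 * (1 - \<tau>\<^sup>2 * (Y * (m Y)\<^sup>2)))"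
  define l where "l = (\<lambda>x Y. c * (1 - q x Y) ^ k)"
  have "axial_parametrization (hyp_sector_profile \<tau>) (\<lambda>x Y. l x Y * s x) (\<lambda>x Y. l x Y * \<tau> * s x * m Y)"
    unfolding axial_parametrization_def
  proof (intro conjI allI impI; (elim conjE)?)
    fix n :: nat assume "0 < n"
    then show "real_polynomial n (\<lambda>x. l (x 0) (axial_sq n x) * s (x 0))"
      "real_polynomial n (\<lambda>x. l (x 0) (axial_sq n x) * \<tau> * s (x 0) * m (axial_sq n x))"
      unfolding l_def q_def s_def m_def by (intro real_polynomial_intros real_polynomial_axial_sq; assumption)+
  next
    fix x y :: real assume xy: "x\<^sup>2 + y\<^sup>2 \<le> 1"
    let ?s = "s x" and ?m = "m (y\<^sup>2)" and ?q = "q x (y\<^sup>2)" and ?l = "l x (y\<^sup>2)"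
    have s: "0 \<le> ?s" "?s \<le> 1" and w: "0 \<le> y\<^sup>2 * ?m\<^sup>2" "y\<^sup>2 * ?m\<^sup>2 \<le> 1"
      using ball_to_cylinder[OF xy] by (auto simp: s_def m_def power_mult_distrib)
    have v: "0 \<le> \<tau>\<^sup>2 * (y\<^sup>2 * ?m\<^sup>2)" "\<tau>\<^sup>2 * (y\<^sup>2 * ?m\<^sup>2) \<le> 1"
      using t2 w by (auto intro!: mult_le_one)
    have s1: "?s\<^sup>2 \<le> 1" using s by (simp add: power_le_one)
    have "0 \<le> ?q" using v unfolding q_def by (intro mult_nonneg_nonneg) auto
    moreover have "?q \<le> 1" using v s1 unfolding q_def by (intro mult_le_one) auto
    ultimately have q: "0 \<le> ?q" "?q \<le> 1" by auto
    have "0 \<le> ?l" using c q by (simp add: l_def)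
    have "(?l * ?s)\<^sup>2 - (y * (?l * \<tau> * ?s * ?m))\<^sup>2 = ?q * ?l\<^sup>2"
      unfolding q_def by (simp add: power2_eq_square algebra_simps)
    also have "\<dots> \<le> 1" using le1[OF q] by (simp add: l_def)
    finally have 1: "(?l * ?s)\<^sup>2 - (y * (?l * \<tau> * ?s * ?m))\<^sup>2 \<le> 1" .
    have "(y * (?l * \<tau> * ?s * ?m))\<^sup>2 = \<tau>\<^sup>2 * (?l * ?s)\<^sup>2 * (y\<^sup>2 * ?m\<^sup>2)"
      by (simp add: power2_eq_square algebra_simps)
    also have "\<dots> \<le> \<tau>\<^sup>2 * (?l * ?s)\<^sup>2 * 1" using w by (intro mult_left_mono) auto
    finally show "hyp_sector_profile \<tau> (?l * ?s) ((y * (?l * \<tau> * ?s * ?m))\<^sup>2)"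
      using 1 s \<open>0 \<le> ?l\<close> by (simp add: hyp_sector_profile_def)
  next
    fix a b :: real assume b: "0 \<le> b" and R: "hyp_sector_profile \<tau> a (b\<^sup>2)"
    from R have a: "0 \<le> a" "b\<^sup>2 \<le> (\<tau> * a)\<^sup>2" "a\<^sup>2 - b\<^sup>2 \<le> 1"
      by (auto simp: hyp_sector_profile_def power_mult_distrib)
    from a(1,2) b assms have "b \<le> \<tau> * a" by (metis mult_nonneg_nonneg less_imp_le power2_le_imp_le)
    \<comment> \<open>At the apex \<open>a = 0\<close> this is \<open>\<sigma> = 0\<close>, which serves as well as any other slope.\<close>
    define \<sigma> where "\<sigma> = b / a"
    have \<sigma>: "0 \<le> \<sigma>" "\<sigma> \<le> \<tau>" "b = a * \<sigma>"
      using \<open>b \<le> \<tau> * a\<close> a b assms by (auto simp: \<sigma>_def divide_simps)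
    have s2: "\<sigma>\<^sup>2 \<le> \<tau>\<^sup>2" using \<sigma> by (simp add: power_mono)
    define U where "U = sqrt (1 - \<sigma>\<^sup>2)"
    have U: "\<delta> \<le> U" "0 < U" "U\<^sup>2 = 1 - \<sigma>\<^sup>2" "a\<^sup>2 * U\<^sup>2 = a\<^sup>2 - b\<^sup>2"
      using s2 t2 \<sigma>(3) by (auto simp: U_def \<delta>_def power_mult_distrib algebra_simps)
    have aU: "(a * U)\<^sup>2 \<le> 1\<^sup>2" "0 \<le> a * U" using U a by (auto simp: power_mult_distrib)
    then have "a * U \<le> 1" by (metis power2_le_imp_le zero_le_one)
    from onto[OF U(1) aU(2) this] obtain u where u: "0 \<le> u" "u \<le> U" "u * (c * (1 - u\<^sup>2) ^ k) = a * U"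
      by blast
    obtain x y where xy: "x\<^sup>2 + y\<^sup>2 \<le> 1" "4 * x\<^sup>2 * (1 - x\<^sup>2) = u / U" "y * (3 - 4 * y\<^sup>2) = \<sigma> / \<tau>"
      using cylinder_from_ball[of "u / U" "\<sigma> / \<tau>"] u U \<sigma> assms by auto
    let ?m = "m (y\<^sup>2)" and ?l = "l x (y\<^sup>2)"
    have s: "s x = u / U" and w: "y * ?m = \<sigma> / \<tau>" using xy by (auto simp: s_def m_def)
    have "\<tau>\<^sup>2 * (y\<^sup>2 * ?m\<^sup>2) = (\<tau> * (y * ?m))\<^sup>2" by (simp add: power_mult_distrib)
    then have "1 - \<tau>\<^sup>2 * (y\<^sup>2 * ?m\<^sup>2) = U\<^sup>2" unfolding w U(3) using assms by simp
    then have "q x (y\<^sup>2) = u\<^sup>2" unfolding q_def s using U(2) by (simp add: power_divide)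
    then have "u * ?l = a * U" using u by (simp add: l_def)
    then have ls: "?l * s x = a" unfolding s using U by (simp add: field_simps)
    have "y * (?l * \<tau> * s x * ?m) = (?l * s x) * (\<tau> * (y * ?m))" by simp
    then have "y * (?l * \<tau> * s x * ?m) = b" unfolding ls w \<sigma>(3) using assms by simp
    with xy ls show "\<exists>x y. x\<^sup>2 + y\<^sup>2 \<le> 1 \<and> l x (y\<^sup>2) * s x = a \<and> y * (l x (y\<^sup>2) * \<tau> * s x * m (y\<^sup>2)) = b"
      by blast
  qed
  then show ?thesis by blast
qed

text \<open>
  The slice at \<open>a = 1 + E s\<^sup>2\<close> is given by \<open>|b| \<le> sqrt (a\<^sup>2 - 1) = s sqrt (E g)\<close> with \<open>g = a + 1 = 2 + E s\<^sup>2\<close>.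
  It is filled by \<open>b = sqrt (a\<^sup>2 - 1) u \<lambda>(u\<^sup>2)\<close> with \<open>\<lambda>(q) = c (1 - q)\<^sup>k\<close> and \<open>u = w sqrt (g / (2 + E))\<close>:
  in the product of the two roots, \<open>sqrt g\<close> becomes \<open>g\<close>, and the constant
  \<open>C = sqrt (E / (2 + E))\<close> remains, so that \<open>b = s g C w \<lambda>(u\<^sup>2)\<close> is polynomial.  In each slice \<open>u\<close> runs up to
  \<open>sqrt (g / (2 + E))\<close>, which is at least \<open>\<delta> = sqrt (2 / (2 + E))\<close>.
\<close>
lemma hyp_segment_parametrization:
  fixes A :: real
  assumes "1 < A"
  shows "\<exists>P Q. axial_parametrization (hyp_segment_profile A) P Q"
proof -
  define E where "E = A - 1"
  have E: "0 < E" using assms by (simp add: E_def)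
  define C where "C = sqrt (E / (2 + E))"
  have C: "C\<^sup>2 = E / (2 + E)" using E by (auto simp: C_def)
  define \<delta> where "\<delta> = sqrt (2 / (2 + E))"
  have "0 < \<delta>" using E by (simp add: \<delta>_def)
  from bump_exists[OF this] obtain k c where c: "0 \<le> c"
    and le1: "\<And>q. \<lbrakk>0 \<le> q; q \<le> 1\<rbrakk> \<Longrightarrow> q * (c * (1 - q) ^ k)\<^sup>2 \<le> 1"
    and onto: "\<And>U h. \<lbrakk>\<delta> \<le> U; 0 \<le> h; h \<le> 1\<rbrakk> \<Longrightarrow> \<exists>u. 0 \<le> u \<and> u \<le> U \<and> u * (c * (1 - u\<^sup>2) ^ k) = h"
    by metis
  define s :: "real \<Rightarrow> real" where "s = (\<lambda>x. 4 * x\<^sup>2 * (1 - x\<^sup>2))"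
  define m :: "real \<Rightarrow> real" where "m = (\<lambda>Y. 3 - 4 * Y)"
  define g where "g = (\<lambda>x. 2 + E * (s x)\<^sup>2)"
  define q where "q = (\<lambda>x Y. g x * (Y * (m Y)\<^sup>2) * (1 / (2 + E)))"
  define l where "l = (\<lambda>x Y. c * (1 - q x Y) ^ k)"
  have "axial_parametrization (hyp_segment_profile A) (\<lambda>x Y. 1 + E * (s x)\<^sup>2)
      (\<lambda>x Y. s x * g x * C * m Y * l x Y)"
    unfolding axial_parametrization_def
  proof (intro conjI allI impI; (elim conjE)?)
    fix n :: nat assume "0 < n"
    then show "real_polynomial n (\<lambda>x. 1 + E * (s (x 0))\<^sup>2)"
      "real_polynomial n (\<lambda>x. s (x 0) * g (x 0) * C * m (axial_sq n x) * l (x 0) (axial_sq n x))"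
      unfolding l_def q_def g_def s_def m_def by (intro real_polynomial_intros real_polynomial_axial_sq; assumption)+
  next
    fix x y :: real assume xy: "x\<^sup>2 + y\<^sup>2 \<le> 1"
    let ?s = "s x" and ?m = "m (y\<^sup>2)" and ?g = "g x" and ?q = "q x (y\<^sup>2)" and ?l = "l x (y\<^sup>2)"
    have s: "0 \<le> ?s" "?s \<le> 1" and w: "0 \<le> y\<^sup>2 * ?m\<^sup>2" "y\<^sup>2 * ?m\<^sup>2 \<le> 1"
      using ball_to_cylinder[OF xy] by (auto simp: s_def m_def power_mult_distrib)
    have s1: "?s\<^sup>2 \<le> 1" using s by (simp add: power_le_one)
    have g: "0 < ?g" "?g \<le> 2 + E" using E s1 by (auto simp: g_def intro: add_pos_nonneg)
    have "?g * (y\<^sup>2 * ?m\<^sup>2) \<le> (2 + E) * 1"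
      using g w E by (intro mult_mono) auto
    then have q: "0 \<le> ?q" "?q \<le> 1" using w g E by (auto simp: q_def)
    have "(y * (?s * ?g * C * ?m * ?l))\<^sup>2 = ?s\<^sup>2 * ?g\<^sup>2 * (y\<^sup>2 * ?m\<^sup>2) * C\<^sup>2 * ?l\<^sup>2"
      by (simp add: power_mult_distrib)
    also have "\<dots> = (E * ?s\<^sup>2 * ?g) * (?q * ?l\<^sup>2)"
      unfolding q_def C by (simp add: power2_eq_square)
    also have "\<dots> \<le> (E * ?s\<^sup>2 * ?g) * 1"
      using le1[OF q] E g by (intro mult_left_mono) (auto simp: l_def)
    also have "\<dots> = (1 + E * ?s\<^sup>2)\<^sup>2 - 1" by (simp add: g_def power2_eq_square algebra_simps)
    finally have "(y * (?s * ?g * C * ?m * ?l))\<^sup>2 \<le> (1 + E * ?s\<^sup>2)\<^sup>2 - 1" .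
    moreover have "1 + E * ?s\<^sup>2 \<le> A" using E s1 mult_left_mono[of "?s\<^sup>2" 1 E] E_def by linarith
    ultimately show "hyp_segment_profile A (1 + E * ?s\<^sup>2) ((y * (?s * ?g * C * ?m * ?l))\<^sup>2)"
      using E by (simp add: hyp_segment_profile_def)
  next
    fix a b :: real assume b: "0 \<le> b" and R: "hyp_segment_profile A a (b\<^sup>2)"
    from R have a: "0 \<le> a" "b\<^sup>2 \<le> a\<^sup>2 - 1" "a \<le> A" by (auto simp: hyp_segment_profile_def)
    have "1\<^sup>2 \<le> a\<^sup>2" unfolding power_one using a(2) zero_le_power2[of b] by linarith
    then have a1: "1 \<le> a" using a by (metis power2_le_imp_le)
    \<comment> \<open>At the vertex \<open>a = 1\<close> this is \<open>h = 0\<close>, and \<open>b = sqrt (a\<^sup>2 - 1) h\<close> still holds as \<open>b = 0\<close>.\<close>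
    define h where "h = b / sqrt (a\<^sup>2 - 1)"
    have bl: "b \<le> sqrt (a\<^sup>2 - 1)" using a b by (simp add: real_le_rsqrt)
    moreover have "0 \<le> sqrt (a\<^sup>2 - 1)" using b bl by linarith
    ultimately have h: "0 \<le> h" "h \<le> 1" using b unfolding h_def by (auto simp only: divide_le_eq_1 zero_le_divide_iff)
    have bh: "b = sqrt (a\<^sup>2 - 1) * h" using bl b unfolding h_def by (cases "sqrt (a\<^sup>2 - 1) = 0") auto
    define U where "U = sqrt ((a + 1) / (2 + E))"
    have U: "\<delta> \<le> U" "0 < U" "U\<^sup>2 = (a + 1) / (2 + E)"
      using a1 E by (auto simp: U_def \<delta>_def divide_right_mono)
    from onto[OF U(1) h] obtain u where u: "0 \<le> u" "u \<le> U" "u * (c * (1 - u\<^sup>2) ^ k) = h"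
      by blast
    have "0 \<le> sqrt ((a - 1) / E)" "sqrt ((a - 1) / E) \<le> 1" using a1 a E by (auto simp: E_def)
    then obtain x y where xy: "x\<^sup>2 + y\<^sup>2 \<le> 1" "4 * x\<^sup>2 * (1 - x\<^sup>2) = sqrt ((a - 1) / E)"
        "y * (3 - 4 * y\<^sup>2) = u / U"
      using cylinder_from_ball[of "sqrt ((a - 1) / E)" "u / U"] u U by auto
    let ?m = "m (y\<^sup>2)" and ?l = "l x (y\<^sup>2)"
    have s: "s x = sqrt ((a - 1) / E)" and w: "y * ?m = u / U" using xy by (auto simp: s_def m_def)
    have Es: "E * (s x)\<^sup>2 = a - 1" unfolding s using a1 E by simp
    then have g: "g x = a + 1" and P: "1 + E * (s x)\<^sup>2 = a" by (auto simp: g_def)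
    have "q x (y\<^sup>2) = U\<^sup>2 * (y * ?m)\<^sup>2" unfolding q_def g U by (simp add: power_mult_distrib)
    then have "q x (y\<^sup>2) = u\<^sup>2" unfolding w using U(2) by (simp add: power_divide)
    then have ul: "u * ?l = h" using u by (simp add: l_def)
    have sgC: "s x * g x * C = sqrt (a\<^sup>2 - 1) * U"
    proof -
      have "sqrt (a\<^sup>2 - 1) = sqrt (a - 1) * sqrt (a + 1)"
        by (simp add: real_sqrt_mult[symmetric] power2_eq_square algebra_simps)
      moreover have "g x = sqrt (a + 1) * sqrt (a + 1)" using a1 g by simp
      ultimately show ?thesis
        unfolding s C_def U_def real_sqrt_divide using E by simp
    qed
    have "y * (s x * g x * C * ?m * ?l) = (s x * g x * C) * (y * ?m) * ?l" by simp
    also have "\<dots> = sqrt (a\<^sup>2 - 1) * (u * ?l)" unfolding sgC w using U by simp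
    also have "\<dots> = b" unfolding ul bh ..
    finally have "y * (s x * g x * C * ?m * ?l) = b" .
    with xy P show "\<exists>x y. x\<^sup>2 + y\<^sup>2 \<le> 1 \<and> 1 + E * (s x)\<^sup>2 = a
        \<and> y * (s x * g x * C * m (y\<^sup>2) * l x (y\<^sup>2)) = b"
      by blast
  qed
  then show ?thesis by blast
qed

section \<open>The sector and the segment are bricks\<close>

text \<open>
  The point \<open>p\<close> must satisfy \<open>a p < 1\<close> for all \<open>a\<close> in the sector, that is, lie below the tangent line of
  the hyperbola at each of its points in the sector.  There \<open>a\<^sup>2 (1 - \<tau>\<^sup>2) \<le> 1\<close>, which explains the choice of \<open>p\<close>.
\<close>
lemma brick_hyp_sector_profile:
  assumes "2 \<le> n" "0 < \<tau>" "\<tau> < 1"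
  shows "brick n n (rotate_planar n {(a, b). hyp_sector_profile \<tau> a (b\<^sup>2)})"
proof -
  have t2: "\<tau>\<^sup>2 < 1" using assms by (simp add: power_less_one_iff)
  define p where "p = sqrt (1 - \<tau>\<^sup>2) / 2"
  have p: "0 < p" "p < 1" "p\<^sup>2 * 4 = 1 - \<tau>\<^sup>2"
  proof -
    have "sqrt (1 - \<tau>\<^sup>2) \<le> sqrt 1" by (intro real_sqrt_le_mono) simp
    moreover have "0 < sqrt (1 - \<tau>\<^sup>2)" using t2 by simp
    ultimately show "0 < p" "p < 1" unfolding p_def real_sqrt_one by linarith+
    show "p\<^sup>2 * 4 = 1 - \<tau>\<^sup>2" using t2 by (simp add: p_def power_divide)
  qed
  obtain P Q where PQ: "axial_parametrization (hyp_sector_profile \<tau>) P Q"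
    using hyp_sector_parametrization assms by blast
  show ?thesis
  proof (rule brick_of_revolution[where R = "hyp_sector_profile \<tau>" and p = p and P = P and Q = Q and
        F = "{\<lambda>a \<beta>. a, \<lambda>a \<beta>. \<tau>\<^sup>2 * a\<^sup>2 - \<beta>, \<lambda>a \<beta>. 1 - (a\<^sup>2 - \<beta>)}"])
    fix f a \<beta> and t :: real
    assume f: "f \<in> {\<lambda>a \<beta>. a, \<lambda>a \<beta>. \<tau>\<^sup>2 * a\<^sup>2 - \<beta>, \<lambda>a \<beta>. 1 - (a\<^sup>2 - \<beta>)}"
      and b: "0 \<le> \<beta>" and R: "hyp_sector_profile \<tau> a \<beta>" and t: "0 < t" "t \<le> 1"
    from R have a: "0 \<le> a" "\<beta> \<le> \<tau>\<^sup>2 * a\<^sup>2" "a\<^sup>2 - \<beta> \<le> 1" by (auto simp: hyp_sector_profile_def)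
    let ?a = "(1 - t) * a + t * p"
    have a': "(1 - t) * a < ?a" "0 \<le> (1 - t) * a" using t a p by auto
    have "(1 - t)\<^sup>2 * \<beta> \<le> (1 - t)\<^sup>2 * (\<tau>\<^sup>2 * a\<^sup>2)" using a by (intro mult_left_mono) auto
    also have "\<dots> = \<tau>\<^sup>2 * ((1 - t) * a)\<^sup>2" by (simp add: power_mult_distrib)
    also have "\<dots> < \<tau>\<^sup>2 * ?a\<^sup>2" using a' assms by (intro mult_strict_left_mono power_strict_mono) auto
    finally have 2: "(1 - t)\<^sup>2 * \<beta> < \<tau>\<^sup>2 * ?a\<^sup>2" .
    have "(2 * (a * p))\<^sup>2 = a\<^sup>2 * (p\<^sup>2 * 4)" by (simp add: power_mult_distrib)
    also have "\<dots> = a\<^sup>2 - \<tau>\<^sup>2 * a\<^sup>2" unfolding p by (simp add: algebra_simps)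
    also have "\<dots> \<le> 1\<^sup>2" using a by simp
    finally have "2 * (a * p) \<le> 1" by (rule power2_le_imp_le) simp
    then have ap: "a * p < 1" by simp
    have p2: "p\<^sup>2 < 1" using p by (simp add: power_less_one_iff)
    have "?a\<^sup>2 - (1 - t)\<^sup>2 * \<beta> = (1 - t)\<^sup>2 * (a\<^sup>2 - \<beta>) + 2 * t * (1 - t) * (a * p) + t\<^sup>2 * p\<^sup>2"
      by (simp add: power2_eq_square algebra_simps)
    \<comment> \<open>The coefficients add up to \<open>((1 - t) + t)\<^sup>2 = 1\<close>.  Strictness comes from the last term, the only
       one whose coefficient is positive for every \<open>t > 0\<close>.\<close>
    also have "\<dots> < (1 - t)\<^sup>2 * 1 + 2 * t * (1 - t) * 1 + t\<^sup>2 * 1"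
      using a ap p2 t by (intro add_le_less_mono add_mono mult_left_mono mult_strict_left_mono) auto
    also have "\<dots> = 1" by (simp add: power2_eq_square algebra_simps)
    finally have 3: "?a\<^sup>2 - (1 - t)\<^sup>2 * \<beta> < 1" .
    show "0 < f ?a ((1 - t)\<^sup>2 * \<beta>)"
      using f a' 2 3 by auto
  qed (use assms PQ in \<open>auto simp: hyp_sector_profile_def intro!: real_polynomial_intros real_polynomial_axial_sq\<close>)
qed

lemma brick_hyp_segment_profile:
  assumes "2 \<le> n" "1 < A"
  shows "brick n n (rotate_planar n {(a, b). hyp_segment_profile A a (b\<^sup>2)})"
proof -
  define p where "p = (1 + A) / 2"
  have p: "1 < p" "p < A" using assms by (auto simp: p_def)
  obtain P Q where PQ: "axial_parametrization (hyp_segment_profile A) P Q"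
    using hyp_segment_parametrization assms by blast
  show ?thesis
  proof (rule brick_of_revolution[where R = "hyp_segment_profile A" and p = p and P = P and Q = Q and
        F = "{\<lambda>a \<beta>. a, \<lambda>a \<beta>. a\<^sup>2 - \<beta> - 1, \<lambda>a \<beta>. A - a}"])
    fix f a \<beta> and t :: real
    assume f: "f \<in> {\<lambda>a \<beta>. a, \<lambda>a \<beta>. a\<^sup>2 - \<beta> - 1, \<lambda>a \<beta>. A - a}"
      and b: "0 \<le> \<beta>" and R: "hyp_segment_profile A a \<beta>" and t: "0 < t" "t \<le> 1"
    from R have a: "0 \<le> a" "1 \<le> a\<^sup>2 - \<beta>" "a \<le> A" by (auto simp: hyp_segment_profile_def)
    let ?a = "(1 - t) * a + t * p"
    have "0 < t * p" "0 \<le> (1 - t) * a" using t a p by auto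
    then have 1: "0 < ?a" by linarith
    have "1\<^sup>2 \<le> a\<^sup>2" using a b by simp
    then have a1: "1 \<le> a" using a by (metis power2_le_imp_le)
    have "1 * 1 \<le> a * p" using a1 p by (intro mult_mono) auto
    then have ap: "1 \<le> a * p" by simp
    have p2: "1 < p\<^sup>2" using p by (simp add: one_less_power)
    have "1 = (1 - t)\<^sup>2 * 1 + 2 * t * (1 - t) * 1 + t\<^sup>2 * 1" by (simp add: power2_eq_square algebra_simps)
    also have "\<dots> < (1 - t)\<^sup>2 * (a\<^sup>2 - \<beta>) + 2 * t * (1 - t) * (a * p) + t\<^sup>2 * p\<^sup>2"
      using a ap p2 t by (intro add_le_less_mono add_mono mult_left_mono mult_strict_left_mono) auto
    also have "\<dots> = ?a\<^sup>2 - (1 - t)\<^sup>2 * \<beta>"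
      by (simp add: power2_eq_square algebra_simps)
    finally have 2: "1 < ?a\<^sup>2 - (1 - t)\<^sup>2 * \<beta>" .
    have "?a < (1 - t) * A + t * A"
      using a p t by (intro add_le_less_mono mult_left_mono mult_strict_left_mono) auto
    then have 3: "?a < A" by (simp add: algebra_simps)
    show "0 < f ?a ((1 - t)\<^sup>2 * \<beta>)"
      using f 1 2 3 by auto
  qed (use assms PQ in \<open>auto simp: hyp_segment_profile_def intro!: real_polynomial_intros real_polynomial_axial_sq\<close>)
qed

theorem theorem2p24:
  fixes n :: nat and \<alpha> :: real
  assumes "n \<ge> 2" and "0 < \<alpha>" and "\<alpha> < pi / 4"
  shows "brick n n (hyp_sector n \<alpha>) \<and> brick n n (hyp_segment n \<alpha>)"
proof
  have "tan \<alpha> < tan (pi / 4)" using assms by (intro tan_monotone) auto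
  then have tan: "0 < tan \<alpha>" "tan \<alpha> < 1" using assms by (auto simp: tan_45 tan_gt_zero)
  then show "brick n n (hyp_sector n \<alpha>)"
    unfolding hyp_sector_def planar_hyp_sector_profile[OF assms(2,3)]
    using assms(1) by (intro brick_hyp_sector_profile)
  have c: "0 < cos \<alpha>" "0 < sin \<alpha>" "0 < cos (2 * \<alpha>)"
    using assms by (auto intro!: cos_gt_zero_pi sin_gt_zero)
  have "cos (2 * \<alpha>) < (cos \<alpha>)\<^sup>2" using c by (simp add: cos_double)
  then have "sqrt (cos (2 * \<alpha>)) < cos \<alpha>" using c by (simp add: real_less_lsqrt)
  then have "1 < cos \<alpha> / sqrt (cos (2 * \<alpha>))" using c by simp
  then show "brick n n (hyp_segment n \<alpha>)"
    unfolding hyp_segment_def planar_hyp_segment_profile[OF assms(2,3)]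
    using assms(1) by (intro brick_hyp_segment_profile)
qed

end
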